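(* For every natural number $m$, the fast Goodstein sequence starting on $m$ terminates in finite time; that is, there is $i<\omega$ with $g^m_i=0$.
   Context: Ordinals: $\varepsilon_0$ is the least ordinal $\varepsilon$ with $\omega^\varepsilon=\varepsilon$. Every $0<\xi<\varepsilon_0$ has a unique $\omega$-normal form $\xi=\omega^{\alpha}b+\gamma$ with $\alpha<\xi$, $b$ a positive natural number and $\gamma<\omega^\alpha$. Coefficients: $\mathrm{coeffs}(0)=\{0\}$, $\mathrm{coeffs}(\omega^\alpha b+\gamma)=\mathrm{coeffs}(\alpha)\cup\mathrm{coeffs}(\gamma)\cup\{b\}$ (in normal form), and $\mathrm{mc}(\xi)=\max\mathrm{coeffs}(\xi)$. Fundamental sequences $\xi[n]$ ($\xi<\varepsilon_0$, $n\in\mathbb N$), by recursion on $\omega$-normal forms: $0[n]=1[n]=0$; $(\omega^\alpha b+\gamma)[n]=\omega^\alpha b+\gamma[n]$ if $\gamma>0$; $\omega^{\alpha+1}[n]=\omega^\alpha n$; $(\omega^\alpha(b+1))[n]=\omega^\alpha b+(\omega^\alpha)[n]$ if $b>0$; $(\omega^\alpha)[n]=\omega^{\alpha[n]}$ if $\alpha$ is a limit. Functions $\mathbb A_k$ ($2\le k<\omega$), $\mathbb A_k:\varepsilon_0\to\mathbb N$ by transfinite recursion: if $\xi<\omega$, $\mathbb A_k(\xi)=\xi+1$. If $\xi\ge\omega$, write $\xi=\alpha+b$ with $\alpha$ a limit and $b<\omega$; set $\mathbb A_k^{(0)}(\xi)=\mathbb A_k(\xi-1)$ if $b>0$ and $\mathbb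 A_k^{(0)}(\xi)=\mathrm{mc}(\xi)$ if $b=0$; $\mathbb A_k^{(i+1)}(\xi)=\mathbb A_k(\alpha[\mathbb A_k^{(i)}(\xi)])$; and $\mathbb A_k(\xi)=\mathbb A_k^{(k)}(\xi)$. $\Omega$ denotes the first uncountable ordinal and $\varepsilon_{\Omega+1}$ the least $\varepsilon>\Omega$ with $\omega^\varepsilon=\varepsilon$. Each $0<\xi<\varepsilon_{\Omega+1}$ has a unique $\Omega$-normal form $\xi=\Omega^\alpha\beta+\gamma$ with $0<\beta<\Omega$, $\gamma<\Omega^\alpha$; $\mathrm{coeffs}_\Omega(0)=\{0\}$, $\mathrm{coeffs}_\Omega(\Omega^\alpha\beta+\gamma)=\mathrm{coeffs}_\Omega(\alpha)\cup\mathrm{coeffs}_\Omega(\gamma)\cup\{\beta\}$, $\mathrm{mc}_\Omega(\xi)=\max\mathrm{coeffs}_\Omega(\xi)$. $\mathbb A_\omega:\varepsilon_{\Omega+1}\to\Omega$ is defined recursively: $\mathbb A_\omega(\xi)$ is the least ordinal $\theta>\mathrm{mc}_\Omega(\xi)$ such that $\mathbb A_\omega(\zeta)<\theta$ for all $\zeta<\xi$ with $\mathrm{mc}_\Omega(\zeta)<\theta$. $k$-normal forms ($2\le k<\omega$): for a positive integer $m$ and $\xi<\varepsilon_0$, $\mathbb A_k(\xi)$ is the $k$-normal form of $m$ (written $m\equiv_k\mathbb A_k(\xi)$) if $m=\mathbb A_k(\xi)$ and there is a sequence $\xi_0,\dots,\xi_n<\varepsilon_0$ with $\xi_0=0$,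 $\xi_n=\xi$, and for each $i<n$, $\xi_{i+1}$ is the maximum $\zeta<\varepsilon_0$ with $\mathbb A_k(\zeta)\le m$ and $\mathrm{mc}(\zeta)\ge\mathbb A_k(\xi_i)$ if such a maximum exists, and $\xi_{i+1}=0$ otherwise. The paper takes for granted that each positive integer has exactly one $k$-normal form. Base change: for $2\le k<\lambda\le\omega$, let $\kappa=\omega$ if $\lambda<\omega$ and $\kappa=\Omega$ if $\lambda=\omega$. Define $x\mapsto x^{\uparrow\lambda}_k$ on natural numbers and ordinals below $\varepsilon_0$ by simultaneous recursion: $0^{\uparrow\lambda}_k=0$; if $m>0$ has $k$-normal form $\mathbb A_k(\xi)$ then $m^{\uparrow\lambda}_k=\mathbb A_\lambda(\xi^{\uparrow\lambda}_k)$; if $\xi=\omega^\alpha b+\gamma$ in $\omega$-normal form then $\xi^{\uparrow\lambda}_k=\kappa^{\alpha^{\uparrow\lambda}_k}\cdot b^{\uparrow\lambda}_k+\gamma^{\uparrow\lambda}_k$. Fast Goodstein sequence starting on $m$: $g^m_0=m$; if $g^m_i>0$ then $g^m_{i+1}=(g^m_i)^{\uparrow (i+3)}_{i+2}-1$; if $g^m_i=0$ the sequence stops. *)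

theory Defs
  imports Main
begin

section \<open>The ordinals below epsilon zero\<close>

text \<open>
  Ordinals below \<open>\<epsilon>\<^sub>0\<close> are represented by their hereditary \<open>\<omega>\<close>-normal forms:
  \<open>W a b c\<close> stands for \<open>\<omega>\<^sup>a * b + c\<close>.
\<close>

datatype cnf = Z | W cnf nat cnf

instantiation cnf :: linorder
begin

fun less_cnf :: "cnf \<Rightarrow> cnf \<Rightarrow> bool" where
  "less_cnf x Z \<longleftrightarrow> False"
| "less_cnf Z (W a b c) \<longleftrightarrow> True"
| "less_cnf (W a b c) (W a' b' c') \<longleftrightarrow>
     less_cnf a a' \<or> a = a' \<and> (b < b' \<or> b = b' \<and> less_cnf c c')"

definition less_eq_cnf :: "cnf \<Rightarrow> cnf \<Rightarrow> bool" where
  "less_eq_cnf x y \<longleftrightarrow> x < y \<or> x = y"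

instance
proof
  have irrefl: "\<not> x < x" for x :: cnf
    by (induction x) auto
  have trans: "x < y \<Longrightarrow> y < z \<Longrightarrow> x < z" for x y z :: cnf
  proof (induction y arbitrary: x z)
    case Z
    then show ?case by simp
  next
    case (W a b c)
    show ?case
    proof (cases x; cases z)
      fix a1 b1 c1 a3 b3 c3 assume "x = W a1 b1 c1" "z = W a3 b3 c3"
      then show ?thesis
        using W.prems W.IH(1)[of a1 a3] W.IH(2)[of c1 c3] by auto
    qed (use W.prems in auto)
  qed
  have total: "x < y \<or> x = y \<or> y < x" for x y :: cnf
  proof (induction x arbitrary: y)
    case Z
    then show ?case by (cases y) auto
  next
    case (W a b c)
    show ?case
    proof (cases y)
      case (W a' b' c')
      then show ?thesis using W.IH(1)[of a'] W.IH(2)[of c'] by auto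
    qed simp
  qed
  fix x y z :: cnf
  show "x < y \<longleftrightarrow> x \<le> y \<and> \<not> y \<le> x"
    using irrefl trans by (auto simp: less_eq_cnf_def)
  show "x \<le> x" by (simp add: less_eq_cnf_def)
  show "x \<le> y \<Longrightarrow> y \<le> z \<Longrightarrow> x \<le> z"
    using trans by (auto simp: less_eq_cnf_def)
  show "x \<le> y \<Longrightarrow> y \<le> x \<Longrightarrow> x = y"
    using irrefl trans by (auto simp: less_eq_cnf_def)
  show "x \<le> y \<or> y \<le> x"
    using total[of x y] by (auto simp: less_eq_cnf_def)
qed

end

lemma Z_less_iff [simp]: "Z < x \<longleftrightarrow> x \<noteq> Z"
  by (cases x) auto

lemma Z_le [simp]: "Z \<le> x"
  by (simp add: le_less eq_commute)

fun nf :: "cnf \<Rightarrow> bool" where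
  "nf Z \<longleftrightarrow> True"
| "nf (W a b c) \<longleftrightarrow> nf a \<and> 0 < b \<and> nf c \<and> c < W a 1 Z"

lemma less_W1: "c < W a (Suc 0) Z \<longleftrightarrow> c = Z \<or> (\<exists>a' b' c'. c = W a' b' c' \<and> (a' < a \<or> a' = a \<and> b' = 0))"
  by (cases c) auto

lemma less_W1_nf: "nf c \<Longrightarrow> c < W a (Suc 0) Z \<longleftrightarrow> c = Z \<or> (\<exists>a' b' c'. c = W a' b' c' \<and> a' < a)"
  by (cases c) auto

lemma wf_cnf: "wf {(x, y). nf x \<and> nf y \<and> x < y}" (is "wf ?R")
proof -
  have step: "W a b c \<in> Wellfounded.acc ?R"
    if a: "a \<in> Wellfounded.acc ?R" and "nf (W a b c)" for a b c
    using a that(2)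
  proof (induction a arbitrary: b c rule: acc.induct)
    case (accI a)
    have small: "c \<in> Wellfounded.acc ?R" if "nf c" "c < W a 1 Z" "nf a" for c
    proof (cases c)
      case Z
      then show ?thesis by (auto intro: acc.accI)
    next
      case (W a' b' c')
      then show ?thesis using that accI.IH[of a' b' c'] by auto
    qed
    have "nf (W a b c) \<Longrightarrow> W a b c \<in> Wellfounded.acc ?R" for b c
    proof (induction b arbitrary: c rule: less_induct)
      case (less b)
      then have "c \<in> Wellfounded.acc ?R" using small[of c] by simp
      then show ?case using less.prems
      proof (induction c rule: acc.induct)
        case inner: (accI c)
        show ?case
        proof (rule acc.accI)
          fix y assume y: "(y, W a b c) \<in> ?R"
          show "y \<in> Wellfounded.acc ?R"
          proof (cases y)
            case Z
            then show ?thesis by (auto intro: acc.accI)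
          next
            case (W a' b' c')
            consider "a' < a" | "a' = a" "b' < b" | "a' = a" "b' = b" "c' < c"
              using y W by auto
            then show ?thesis
            proof cases
              case 1
              then show ?thesis using accI.IH[of a' b' c'] y W by auto
            next
              case 2
              then show ?thesis using less.IH[of b' c'] y W by auto
            next
              case 3
              then show ?thesis using inner.IH[of c'] y W inner.prems by auto
            qed
          qed
        qed
      qed
    qed
    then show ?case using accI.prems by blast
  qed
  have nf_acc: "nf x \<Longrightarrow> x \<in> Wellfounded.acc ?R" for x
  proof (induction x)
    case Z
    then show ?case by (auto intro: acc.accI)
  next
    case (W a b c)
    then show ?case using step by simp
  qed
  have "x \<in> Wellfounded.acc ?R" for x
    by (cases "nf x") (auto intro: nf_acc acc.accI)
  then show ?thesis
    by (simp add: wf_iff_acc)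
qed

typedef e0 = "{x. nf x}"
  by (rule exI[of _ Z]) simp

setup_lifting type_definition_e0

instantiation e0 :: "{wellorder, zero}"
begin

lift_definition less_e0 :: "e0 \<Rightarrow> e0 \<Rightarrow> bool" is "(<)" .
lift_definition less_eq_e0 :: "e0 \<Rightarrow> e0 \<Rightarrow> bool" is "(\<le>)" .
lift_definition zero_e0 :: e0 is Z by simp

instance
proof
  fix x y z :: e0
  show "x < y \<longleftrightarrow> x \<le> y \<and> \<not> y \<le> x" by transfer auto
  show "x \<le> x" by transfer auto
  show "x \<le> y \<Longrightarrow> y \<le> z \<Longrightarrow> x \<le> z" by transfer auto
  show "x \<le> y \<Longrightarrow> y \<le> x \<Longrightarrow> x = y" by transfer auto
  show "x \<le> y \<or> y \<le> x" by transfer auto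
next
  fix P :: "e0 \<Rightarrow> bool" and x :: e0
  assume step: "\<And>x. (\<And>y. y < x \<Longrightarrow> P y) \<Longrightarrow> P x"
  have "wf {(x, y :: e0). x < y}"
    by (rule wf_subset[OF wf_inv_image[OF wf_cnf, of Rep_e0]])
      (use Rep_e0 in \<open>auto simp: inv_image_def less_e0.rep_eq\<close>)
  then show "P x"
    by (induction x rule: wf_induct_rule) (auto intro: step)
qed

end

fun add_cnf :: "cnf \<Rightarrow> cnf \<Rightarrow> cnf" where
  "add_cnf x Z = x"
| "add_cnf Z y = y"
| "add_cnf (W a b c) (W a' b' c') =
     (if a < a' then W a' b' c'
      else if a = a' then W a (b + b') c'
      else W a b (add_cnf c (W a' b' c')))"

lemma add_cnf_Z_left [simp]: "add_cnf Z y = y"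
  by (cases y) auto

lemma add_cnf_less_W1:
  "nf x \<Longrightarrow> nf y \<Longrightarrow> x < W a (Suc 0) Z \<Longrightarrow> y < W a (Suc 0) Z \<Longrightarrow> add_cnf x y < W a (Suc 0) Z"
  by (induction x y rule: add_cnf.induct) auto

lemma nf_add_cnf: "nf x \<Longrightarrow> nf y \<Longrightarrow> nf (add_cnf x y)"
proof (induction x y rule: add_cnf.induct)
  case (3 a b c a' b' c')
  then show ?case using add_cnf_less_W1[of c "W a' b' c'" a] by auto
qed auto

instantiation e0 :: plus
begin
lift_definition plus_e0 :: "e0 \<Rightarrow> e0 \<Rightarrow> e0" is add_cnf by (rule nf_add_cnf)
instance ..
end

text \<open>\<open>omega_mult a n\<close> is the ordinal \<open>\<omega>\<^sup>a * n\<close>, and \<open>nat_e0 n\<close> is the finite ordinal \<open>n\<close>.\<close>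

lift_definition omega_mult :: "e0 \<Rightarrow> nat \<Rightarrow> e0" is "\<lambda>a n. if n = 0 then Z else W a n Z"
  by simp

definition nat_e0 :: "nat \<Rightarrow> e0" where
  "nat_e0 n = omega_mult 0 n"

text \<open>
  The exponent, coefficient and remainder of the \<open>\<omega>\<close>-normal form of a nonzero ordinal
  (see \<open>omega_normal_form\<close> below).
\<close>

primrec exp_cnf where "exp_cnf Z = Z" | "exp_cnf (W a b c) = a"
primrec coeff_cnf where "coeff_cnf Z = 0" | "coeff_cnf (W a b c) = b"
primrec rem_cnf where "rem_cnf Z = Z" | "rem_cnf (W a b c) = c"

lift_definition nf_exp :: "e0 \<Rightarrow> e0" is exp_cnf by (case_tac cnf) auto
lift_definition nf_coeff :: "e0 \<Rightarrow> nat" is coeff_cnf .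
lift_definition nf_rem :: "e0 \<Rightarrow> e0" is rem_cnf by (case_tac cnf) auto

definition is_nf :: "e0 \<Rightarrow> e0 \<Rightarrow> nat \<Rightarrow> e0 \<Rightarrow> bool" where
  "is_nf \<xi> \<alpha> b \<gamma> \<longleftrightarrow> \<xi> = omega_mult \<alpha> b + \<gamma> \<and> \<alpha> < \<xi> \<and> 0 < b \<and> \<gamma> < omega_mult \<alpha> 1"

lemma less_W_self: "a < W a b c"
proof (induction a arbitrary: b c)
  case (W a' b' c')
  then show ?case by auto
qed simp

lemma Rep_is_nf:
  "is_nf \<xi> \<alpha> b \<gamma> \<longleftrightarrow> Rep_e0 \<xi> = W (Rep_e0 \<alpha>) b (Rep_e0 \<gamma>)"
proof -
  have *: "nf c \<Longrightarrow> c < W a (Suc 0) Z \<Longrightarrow> 0 < b \<Longrightarrow> add_cnf (W a b Z) c = W a b c" for a b c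
    by (cases c) auto
  show ?thesis
    unfolding is_nf_def
    by transfer (auto simp: * less_W_self)
qed

lemma omega_normal_form:
  assumes "\<xi> \<noteq> 0"
  shows "is_nf \<xi> \<alpha> b \<gamma> \<longleftrightarrow> \<alpha> = nf_exp \<xi> \<and> b = nf_coeff \<xi> \<and> \<gamma> = nf_rem \<xi>"
  using assms unfolding Rep_is_nf
  by transfer (case_tac \<xi>; auto)

lemma is_nf_omega_mult: "0 < b \<Longrightarrow> \<gamma> < omega_mult \<alpha> 1 \<Longrightarrow> is_nf (omega_mult \<alpha> b + \<gamma>) \<alpha> b \<gamma>"
proof -
  have *: "nf c \<Longrightarrow> c < W a (Suc 0) Z \<Longrightarrow> 0 < b \<Longrightarrow> add_cnf (W a b Z) c = W a b c" for a b c
    by (cases c) auto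
  show "0 < b \<Longrightarrow> \<gamma> < omega_mult \<alpha> 1 \<Longrightarrow> is_nf (omega_mult \<alpha> b + \<gamma>) \<alpha> b \<gamma>"
    unfolding Rep_is_nf by transfer (auto simp: *)
qed

text \<open>
  The following facts pin down the arithmetic: addition is strictly increasing in its second
  argument and \<open>\<delta> \<ge> \<alpha>\<close> can be written \<open>\<alpha> + \<beta>\<close>; powers of \<open>\<omega>\<close> are strictly increasing,
  \<open>\<omega>\<^sup>\<alpha>\<close> is the supremum of the \<open>\<omega>\<^sup>\<beta> * n\<close> with \<open>\<beta> < \<alpha>\<close>, and there is no fixed point
  \<open>\<omega>\<^sup>\<alpha> = \<alpha>\<close>.
\<close>

lemma add_zero_e0 [simp]: "\<alpha> + 0 = (\<alpha> :: e0)" "0 + \<alpha> = (\<alpha> :: e0)"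
  by (transfer, simp)+

lemma add_e0_strict_mono: "\<beta> < \<gamma> \<Longrightarrow> \<alpha> + \<beta> < \<alpha> + (\<gamma> :: e0)"
proof transfer
  show "nf a \<Longrightarrow> nf b \<Longrightarrow> nf c \<Longrightarrow> b < c \<Longrightarrow> add_cnf a b < add_cnf a c" for a b c
  proof (induction a arbitrary: b c)
    case (W a1 b1 c1)
    obtain a3 b3 c3 where c: "c = W a3 b3 c3" using W.prems by (cases c) auto
    have 1: "c1 < add_cnf c1 c" using W.IH(2)[of Z c] W.prems c by simp
    show ?case
    proof (cases b)
      case Z
      then show ?thesis using W.prems c 1 by auto
    next
      case (W a2 b2 c2)
      then show ?thesis using W.prems W.IH(2)[of b c] \<open>b < c\<close> \<open>nf b\<close> \<open>nf c\<close> \<open>nf (W a1 b1 c1)\<close> c 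
        by auto
    qed
  qed simp
qed

lemma add_e0_diff: "\<alpha> \<le> \<delta> \<Longrightarrow> \<exists>\<beta>. \<delta> = \<alpha> + (\<beta> :: e0)"
proof -
  have "\<alpha> \<le> \<delta> \<Longrightarrow> \<exists>\<beta>\<in>{x. nf x}. Rep_e0 \<delta> = add_cnf (Rep_e0 \<alpha>) \<beta>"
  proof transfer
    show "nf a \<Longrightarrow> nf d \<Longrightarrow> a \<le> d \<Longrightarrow> \<exists>b\<in>{x. nf x}. d = add_cnf a b" for a d
    proof (induction a arbitrary: d)
      case Z
      then show ?case by auto
    next
      case (W a1 b1 c1)
      obtain a2 b2 c2 where d: "d = W a2 b2 c2" using W.prems by (cases d) (auto simp: le_less)
      consider "a1 < a2" | "a1 = a2" "b1 < b2" | "a1 = a2" "b1 = b2" "c1 \<le> c2"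
        using W.prems d by (auto simp: le_less)
      then show ?case
      proof cases
        case 1
        then show ?thesis using d W.prems by (intro bexI[of _ d]) auto
      next
        case 2
        then show ?thesis using d W.prems by (intro bexI[of _ "W a1 (b2 - b1) c2"]) auto
      next
        case 3
        then obtain b where b: "nf b" "c2 = add_cnf c1 b" using W.IH(2)[of c2] W.prems d by auto
        have "b < W a1 (Suc 0) Z"
        proof (rule ccontr)
          assume "\<not> ?thesis"
          then have le: "W a1 (Suc 0) Z \<le> b" by simp
          then obtain p q r where p: "b = W p q r" by (cases b) (auto simp: le_less)
          then have "a1 \<le> p" using le by (auto simp: le_less)
          then have "b \<le> add_cnf c1 b"
            using p W.prems by (cases c1) (auto simp: le_less)
          then show False using b le W.prems d 3 by auto
        qed
        then show ?thesis using d W.prems 3 b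
          by (intro bexI[of _ b]) (cases b; auto)+
      qed
    qed
  qed
  then obtain b where "nf b" "Rep_e0 \<delta> = add_cnf (Rep_e0 \<alpha>) b" if "\<alpha> \<le> \<delta>" by auto
  then show "\<alpha> \<le> \<delta> \<Longrightarrow> ?thesis"
    by (intro exI[of _ "Abs_e0 b"])
      (metis Abs_e0_inverse Rep_e0_inject mem_Collect_eq plus_e0.rep_eq)
qed

lemma omega_mult_strict_mono: "\<alpha> < \<beta> \<Longrightarrow> omega_mult \<alpha> n < omega_mult \<beta> 1"
  by transfer auto

lemma less_omega_power: "\<delta> < omega_mult \<alpha> 1 \<Longrightarrow> \<delta> \<noteq> 0 \<Longrightarrow> \<exists>\<beta><\<alpha>. \<exists>n. \<delta> < omega_mult \<beta> n"
proof -
  assume *: "\<delta> < omega_mult \<alpha> 1" "\<delta> \<noteq> 0"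
  have "nf_exp \<delta> < \<alpha> \<and> \<delta> < omega_mult (nf_exp \<delta>) (Suc (nf_coeff \<delta>))"
    using * by transfer (case_tac \<delta>; auto)
  then show ?thesis by blast
qed

lemma no_epsilon: "\<alpha> < omega_mult \<alpha> 1"
  by transfer (simp add: less_W_self)


section \<open>Coefficients, limits and fundamental sequences\<close>

primrec coeffs_cnf :: "cnf \<Rightarrow> nat set" where
  "coeffs_cnf Z = {0}"
| "coeffs_cnf (W a b c) = coeffs_cnf a \<union> coeffs_cnf c \<union> {b}"

lift_definition coeffs :: "e0 \<Rightarrow> nat set" is coeffs_cnf .

definition mc :: "e0 \<Rightarrow> nat" where
  "mc \<xi> = Max (coeffs \<xi>)"

lemma coeffs_nf:
  "coeffs 0 = {0}"
  "is_nf \<xi> \<alpha> b \<gamma> \<Longrightarrow> coeffs \<xi> = coeffs \<alpha> \<union> coeffs \<gamma> \<union> {b}"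
  unfolding Rep_is_nf by (transfer, simp)+

definition is_limit :: "e0 \<Rightarrow> bool" where
  "is_limit \<alpha> \<longleftrightarrow> \<alpha> \<noteq> 0 \<and> (\<nexists>\<beta>. \<alpha> = \<beta> + nat_e0 1)"

text \<open>
  \<open>lim_part \<xi>\<close> and \<open>fin_part \<xi>\<close> are the unique \<open>\<alpha>\<close> and \<open>b < \<omega>\<close> such that \<open>\<xi> = \<alpha> + b\<close> and
  \<open>\<alpha>\<close> is zero or a limit.
\<close>

primrec lim_cnf :: "cnf \<Rightarrow> cnf" where
  "lim_cnf Z = Z"
| "lim_cnf (W a b c) = (if a = Z then Z else W a b (lim_cnf c))"

primrec fin_cnf :: "cnf \<Rightarrow> nat" where
  "fin_cnf Z = 0"
| "fin_cnf (W a b c) = (if a = Z then b else fin_cnf c)"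

lemma lim_cnf_le: "lim_cnf x \<le> x"
  by (induction x) (auto simp: le_less)

lemma nf_lim_cnf: "nf x \<Longrightarrow> nf (lim_cnf x)"
proof (induction x)
  case (W a b c)
  then show ?case using lim_cnf_le[of c] by auto
qed simp

lift_definition lim_part :: "e0 \<Rightarrow> e0" is lim_cnf by (rule nf_lim_cnf)
lift_definition fin_part :: "e0 \<Rightarrow> nat" is fin_cnf .

text \<open>
  \<open>fs_cnf \<xi> n\<close> is \<open>\<xi>[n]\<close>. When an exponent is a successor \<open>\<alpha> + 1\<close>, its predecessor is
  \<open>(\<alpha> + 1)[n]\<close> for any \<open>n\<close>.  The defining equations of \<open>\<xi>[n]\<close> are
  proved as \<open>fs_equations\<close> below.
\<close>

fun fs_cnf :: "cnf \<Rightarrow> nat \<Rightarrow> cnf" where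
  "fs_cnf Z n = Z"
| "fs_cnf (W a b c) n =
     (if c \<noteq> Z then W a b (fs_cnf c n)
      else
        let d = (if a = Z then Z
                 else if fin_cnf a > 0 then (if n = 0 then Z else W (fs_cnf a n) n Z)
                 else W (fs_cnf a n) 1 Z)
        in if b = 1 then d else W a (b - 1) d)"

lemma fs_cnf_less: "x \<noteq> Z \<Longrightarrow> nf x \<Longrightarrow> fs_cnf x n < x"
proof (induction x n rule: fs_cnf.induct)
  case (2 a b c n)
  show ?case
  proof (cases "c = Z")
    case True
    then show ?thesis using 2 by (auto simp: Let_def)
  next
    case False
    then show ?thesis using 2 by auto
  qed
qed simp

lemma nf_fs_cnf: "nf x \<Longrightarrow> nf (fs_cnf x n)"
proof (induction x n rule: fs_cnf.induct)
  case (2 a b c n)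
  show ?case
  proof (cases "c = Z")
    case True
    then show ?thesis using 2 fs_cnf_less[of a n] by (auto simp: Let_def)
  next
    case False
    then have "fs_cnf c n < W a 1 Z" using fs_cnf_less[of c n] 2 by auto
    then show ?thesis using 2 False by auto
  qed
qed simp

lift_definition fs :: "e0 \<Rightarrow> nat \<Rightarrow> e0" is fs_cnf by (rule nf_fs_cnf)

lemma fs_less: "\<xi> \<noteq> 0 \<Longrightarrow> fs \<xi> n < \<xi>"
  by transfer (rule fs_cnf_less)

lemma add_1_cnf: "nf x \<Longrightarrow> fin_cnf (add_cnf x (W Z (Suc 0) Z)) = Suc (fin_cnf x)
    \<and> fs_cnf (add_cnf x (W Z (Suc 0) Z)) n = x
    \<and> lim_cnf (add_cnf x (W Z (Suc 0) Z)) = lim_cnf x"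
proof (induction x)
  case (W a b c)
  have "add_cnf c (W Z (Suc 0) Z) \<noteq> Z" by (cases c) auto
  then show ?case using W by (auto simp: less_W1)
qed simp

lemma fin_add_lim_cnf: "nf x \<Longrightarrow> 
  x = add_cnf (lim_cnf x) (if fin_cnf x = 0 then Z else W Z (fin_cnf x) Z)"
proof (induction x)
  case (W a b c)
  then show ?case by (auto simp: less_W1 split: if_splits)
qed simp

lemma fin_part_add_1: "fin_part (\<alpha> + nat_e0 1) = Suc (fin_part \<alpha>)"
  and fs_add_1: "fs (\<alpha> + nat_e0 1) n = \<alpha>"
  and lim_part_add_1: "lim_part (\<alpha> + nat_e0 1) = lim_part \<alpha>"
  unfolding nat_e0_def by (transfer, simp add: add_1_cnf)+

lemma lim_fin_part: "\<xi> = lim_part \<xi> + nat_e0 (fin_part \<xi>)"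
  unfolding nat_e0_def by transfer (use fin_add_lim_cnf in auto)

lemma add_nat_e0_Suc: "\<alpha> + nat_e0 (Suc n) = (\<alpha> + nat_e0 n) + nat_e0 1"
proof -
  have "add_cnf x (W Z (Suc n) Z) = add_cnf (add_cnf x (W Z n Z)) (W Z (Suc 0) Z)"
    if "n > 0" for x n
    by (induction x) (use that in auto)
  then show ?thesis
    unfolding nat_e0_def by transfer auto
qed

lemma is_limit_iff: "is_limit \<alpha> \<longleftrightarrow> \<alpha> \<noteq> 0 \<and> fin_part \<alpha> = 0"
proof -
  have "\<exists>\<beta>. \<alpha> = \<beta> + nat_e0 1" if "fin_part \<alpha> = Suc n" for n
    using lim_fin_part[of \<alpha>] that add_nat_e0_Suc by metis
  then show ?thesis
    unfolding is_limit_def using fin_part_add_1 by (metis nat.distinct(1) not0_implies_Suc)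
qed

lemma fin_part_lim_part: "fin_part (lim_part \<xi>) = 0"
proof transfer
  show "nf x \<Longrightarrow> fin_cnf (lim_cnf x) = 0" for x by (induction x) auto
qed

lemma lim_part_limit: "lim_part \<xi> = 0 \<or> is_limit (lim_part \<xi>)"
  by (simp add: is_limit_iff fin_part_lim_part)

lemma lim_part_unique:
  assumes "\<alpha> = 0 \<or> is_limit \<alpha>"
  shows "lim_part (\<alpha> + nat_e0 b) = \<alpha> \<and> fin_part (\<alpha> + nat_e0 b) = b"
proof -
  have "nat_e0 0 = 0" unfolding nat_e0_def by transfer simp
  moreover have "fin_part 0 = 0" by transfer simp
  ultimately have "fin_part \<alpha> = 0" "lim_part \<alpha> = \<alpha>" "nat_e0 0 = 0"
    using assms lim_fin_part[of \<alpha>] by (metis is_limit_iff add_zero_e0(1))+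
  then show ?thesis
  proof (induction b)
    case (Suc b)
    then show ?case
      using fin_part_add_1[of "\<alpha> + nat_e0 b"] lim_part_add_1[of "\<alpha> + nat_e0 b"]
      unfolding add_nat_e0_Suc[of \<alpha> b] by simp
  qed simp
qed

lemma lim_part_le: "lim_part \<xi> \<le> \<xi>"
  by transfer (rule lim_cnf_le)

lemma lim_part_eq_0_iff: "lim_part \<xi> = 0 \<longleftrightarrow> \<xi> < omega_mult (nat_e0 1) 1"
proof (unfold nat_e0_def, transfer)
  fix x assume "nf x"
  then show "lim_cnf x = Z \<longleftrightarrow> x < (if (1::nat) = 0 then Z else W (if (1::nat) = 0 then Z else W Z 1 Z) 1 Z)"
    by (cases x) (auto simp: less_W1_nf)
qed

lemma fs_equations:
  "fs 0 n = 0"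
  "fs (nat_e0 1) n = 0"
  "is_nf \<xi> \<alpha> b \<gamma> \<Longrightarrow> \<gamma> > 0 \<Longrightarrow> fs \<xi> n = omega_mult \<alpha> b + fs \<gamma> n"
  "fs (omega_mult (\<alpha> + nat_e0 1) 1) n = omega_mult \<alpha> n"
  "b > 0 \<Longrightarrow> fs (omega_mult \<alpha> (b + 1)) n = omega_mult \<alpha> b + fs (omega_mult \<alpha> 1) n"
  "is_limit \<alpha> \<Longrightarrow> fs (omega_mult \<alpha> 1) n = omega_mult (fs \<alpha> n) 1"
proof -
  show "fs 0 n = 0" by transfer simp
  show "fs (nat_e0 1) n = 0" unfolding nat_e0_def by transfer simp
  show "fs (omega_mult (\<alpha> + nat_e0 1) 1) n = omega_mult \<alpha> n"
    unfolding nat_e0_def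
  proof transfer
    fix x n assume "nf x"
    moreover have "add_cnf x (W Z (Suc 0) Z) \<noteq> Z" by (cases x) auto
    ultimately show "fs_cnf (if (1::nat) = 0 then Z else
        W (add_cnf x (if (1::nat) = 0 then Z else W Z 1 Z)) 1 Z) n = (if n = 0 then Z else W x n Z)"
      using add_1_cnf[of x n] by simp
  qed
  show "is_limit \<alpha> \<Longrightarrow> fs (omega_mult \<alpha> 1) n = omega_mult (fs \<alpha> n) 1"
    unfolding is_limit_iff by transfer auto
  have small: "nf c \<Longrightarrow> c < W a (Suc 0) Z \<Longrightarrow> b > 0 \<Longrightarrow> add_cnf (W a b Z) c = W a b c" for a b c
    by (cases c) auto
  show "b > 0 \<Longrightarrow> fs (omega_mult \<alpha> (b + 1)) n = omega_mult \<alpha> b + fs (omega_mult \<alpha> 1) n"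
  proof transfer
    fix b n :: nat and a assume *: "0 < b" "nf a"
    have "fs_cnf (W a (Suc 0) Z) n < W a (Suc 0) Z" "nf (fs_cnf (W a (Suc 0) Z) n)"
      using * by (intro fs_cnf_less nf_fs_cnf; simp)+
    from small[OF this(2,1) *(1)] * show "fs_cnf (if b + 1 = 0 then Z else W a (b + 1) Z) n =
        add_cnf (if b = 0 then Z else W a b Z) (fs_cnf (if (1::nat) = 0 then Z else W a 1 Z) n)"
      by simp
  qed
  assume "is_nf \<xi> \<alpha> b \<gamma>" "\<gamma> > 0"
  then show "fs \<xi> n = omega_mult \<alpha> b + fs \<gamma> n"
    unfolding Rep_is_nf
  proof transfer
    fix x a b c n assume *: "nf x" "x = W a b c" "Z < c"
    have "fs_cnf c n < W a (Suc 0) Z" "nf (fs_cnf c n)"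
      using * fs_cnf_less[of c n] nf_fs_cnf[of c n] by auto
    from small[OF this(2,1), of b] * show
      "fs_cnf x n = add_cnf (if b = 0 then Z else W a b Z) (fs_cnf c n)" by auto
  qed
qed


section \<open>The functions \<open>A\<^sub>k\<close>\<close>

lemma lim_part_pred_less: "0 < fin_part \<xi> \<Longrightarrow> lim_part \<xi> + nat_e0 (fin_part \<xi> - 1) < \<xi>"
proof -
  assume "0 < fin_part \<xi>"
  then obtain n where n: "fin_part \<xi> = Suc n" using gr0_conv_Suc by blast
  have "nat_e0 n < nat_e0 (Suc n)" unfolding nat_e0_def by transfer simp
  from add_e0_strict_mono[OF this, of "lim_part \<xi>"]
  show ?thesis using n lim_fin_part[of \<xi>] by simp
qed

text \<open>
  \<open>fastA k\<close> is \<open>A\<^sub>k\<close>. For \<open>\<xi> \<ge> \<omega>\<close>, the \<open>k\<close>-fold iterate runs through the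
  values \<open>A\<^sub>k\<^sup>(\<^sup>i\<^sup>)(\<xi>)\<close> for \<open>i = 0, \<dots>, k\<close>.
\<close>

function fastA :: "nat \<Rightarrow> e0 \<Rightarrow> nat" where
  "fastA k \<xi> =
     (if \<xi> < omega_mult (nat_e0 1) 1 then fin_part \<xi> + 1
      else ((\<lambda>x. fastA k (fs (lim_part \<xi>) x)) ^^ k)
             (if fin_part \<xi> > 0 then fastA k (lim_part \<xi> + nat_e0 (fin_part \<xi> - 1)) else mc \<xi>))"
  by auto
termination
proof (relation "inv_image {(x, y :: e0). x < y} snd", goal_cases)
  case 1
  then show ?case by (simp add: wf)
next
  case (2 k \<xi> x)
  then have "lim_part \<xi> \<noteq> 0" by (simp add: lim_part_eq_0_iff)
  then show ?case using fs_less[of "lim_part \<xi>" x] lim_part_le[of \<xi>] by auto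
next
  case (3 k \<xi>)
  then show ?case using lim_part_pred_less[of \<xi>] by simp
qed

declare fastA.simps [simp del]


section \<open>Bounds on \<open>A\<^sub>k\<close>\<close>

lemma finite_coeffs_cnf [simp]: "finite (coeffs_cnf x)"
  by (induction x) auto

lemma zero_in_coeffs_cnf: "0 \<in> coeffs_cnf x"
  by (induction x) auto

lemma finite_coeffs: "finite (coeffs \<xi>)"
  by transfer simp

lemma coeffs_le_mc: "b \<in> coeffs \<xi> \<Longrightarrow> b \<le> mc \<xi>"
  by (simp add: mc_def finite_coeffs)

lemma mc_less_iff: "mc \<xi> < n \<longleftrightarrow> (\<forall>b\<in>coeffs \<xi>. b < n)"
proof -
  have "coeffs \<xi> \<noteq> {}" by transfer (use zero_in_coeffs_cnf in blast)
  then show ?thesis by (simp add: mc_def finite_coeffs)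
qed

lemma mc_mono: "coeffs \<xi> \<subseteq> coeffs \<zeta> \<Longrightarrow> mc \<xi> \<le> mc \<zeta>"
  using mc_less_iff[of \<xi> "Suc (mc \<zeta>)"] coeffs_le_mc[of _ \<zeta>] by (auto simp: less_Suc_eq_le)

lemma mc_nf_parts:
  assumes "\<xi> \<noteq> 0"
  shows "mc (nf_exp \<xi>) \<le> mc \<xi>" "mc (nf_rem \<xi>) \<le> mc \<xi>" "nf_coeff \<xi> \<le> mc \<xi>" "0 < nf_coeff \<xi>"
proof -
  have "is_nf \<xi> (nf_exp \<xi>) (nf_coeff \<xi>) (nf_rem \<xi>)" using omega_normal_form[OF assms] by blast
  from coeffs_nf(2)[OF this] this
  have *: "coeffs \<xi> = coeffs (nf_exp \<xi>) \<union> coeffs (nf_rem \<xi>) \<union> {nf_coeff \<xi>}" "0 < nf_coeff \<xi>"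
    by (simp_all add: is_nf_def)
  show "mc (nf_exp \<xi>) \<le> mc \<xi>" by (rule mc_mono) (use *(1) in blast)
  show "mc (nf_rem \<xi>) \<le> mc \<xi>" by (rule mc_mono) (use *(1) in blast)
  show "nf_coeff \<xi> \<le> mc \<xi>" by (rule coeffs_le_mc) (use *(1) in blast)
  show "0 < nf_coeff \<xi>" by (rule *(2))
qed

lemma le_mc_fs: "is_limit \<alpha> \<Longrightarrow> n \<le> mc (fs \<alpha> n)"
proof -
  have "\<exists>b\<in>coeffs_cnf (fs_cnf x n). n \<le> b" if "nf x" "x \<noteq> Z" "fin_cnf x = 0" for x
    using that
  proof (induction x n rule: fs_cnf.induct)
    case (2 a b c n)
    then have a: "a \<noteq> Z" by auto
    show ?case
    proof (cases "c = Z")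
      case True
      then show ?thesis using 2 a zero_in_coeffs_cnf[of a] by (auto simp: Let_def)
    next
      case False
      then show ?thesis using 2 a by auto
    qed
  qed simp
  then have "\<exists>b\<in>coeffs (fs \<alpha> n). n \<le> b" if "is_limit \<alpha>"
    using that unfolding is_limit_iff by transfer auto
  then show "is_limit \<alpha> \<Longrightarrow> ?thesis" using coeffs_le_mc le_trans by blast
qed

lemma mc_finite: "lim_part \<xi> = 0 \<Longrightarrow> mc \<xi> \<le> fin_part \<xi>"
proof -
  have "nf x \<Longrightarrow> lim_cnf x = Z \<Longrightarrow> coeffs_cnf x \<subseteq> {0, fin_cnf x}" for x
    by (cases x) (auto simp: less_W1_nf split: if_splits)
  then have "coeffs \<xi> \<subseteq> {0, fin_part \<xi>}" if "lim_part \<xi> = 0" using that by transfer auto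
  then show "lim_part \<xi> = 0 \<Longrightarrow> ?thesis" using mc_less_iff[of \<xi> "Suc (fin_part \<xi>)"] by auto
qed

lemma mc_pred: "0 < fin_part \<xi> \<Longrightarrow> mc \<xi> \<le> Suc (mc (lim_part \<xi> + nat_e0 (fin_part \<xi> - 1)))"
proof -
  assume pos: "0 < fin_part \<xi>"
  define \<eta> where "\<eta> = lim_part \<xi> + nat_e0 (fin_part \<xi> - 1)"
  have eq: "\<xi> = \<eta> + nat_e0 1"
    using lim_fin_part[of \<xi>] pos add_nat_e0_Suc[of "lim_part \<xi>" "fin_part \<xi> - 1"]
    unfolding \<eta>_def by simp
  have "nf x \<Longrightarrow> fin_cnf x \<in> coeffs_cnf x" for x by (induction x) auto
  then have fin: "fin_part \<eta> \<in> coeffs \<eta>" by transfer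
  have "coeffs_cnf (add_cnf x (W Z (Suc 0) Z)) \<subseteq> coeffs_cnf x \<union> {Suc (fin_cnf x)}" if "nf x" for x
    using that
  proof (induction x)
    case (W a b c)
    then show ?case by (auto simp: less_W1_nf)
  qed simp
  then have "coeffs \<xi> \<subseteq> coeffs \<eta> \<union> {Suc (fin_part \<eta>)}"
    unfolding eq nat_e0_def by transfer simp
  then show ?thesis
    using mc_less_iff[of \<xi> "Suc (Suc (mc \<eta>))"] coeffs_le_mc[OF fin] coeffs_le_mc[of _ \<eta>]
    unfolding \<eta>_def[symmetric] by (fastforce simp: less_Suc_eq_le)
qed

lemma fastA_finite: "lim_part \<xi> = 0 \<Longrightarrow> fastA k \<xi> = fin_part \<xi> + 1"
  by (subst fastA.simps) (simp add: lim_part_eq_0_iff)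

lemma fastA_infinite: "lim_part \<xi> \<noteq> 0 \<Longrightarrow> fastA k \<xi> =
     ((\<lambda>x. fastA k (fs (lim_part \<xi>) x)) ^^ k)
       (if fin_part \<xi> > 0 then fastA k (lim_part \<xi> + nat_e0 (fin_part \<xi> - 1)) else mc \<xi>)"
  by (subst fastA.simps) (simp add: lim_part_eq_0_iff)

lemma iterate_ge: "(\<And>x :: nat. x < f x) \<Longrightarrow> s + i \<le> (f ^^ i) s"
proof (induction i)
  case (Suc i)
  have "(f ^^ i) s < f ((f ^^ i) s)" using Suc.prems .
  then show ?case using Suc.IH[OF Suc.prems] by simp
qed simp

lemma mc_less_fastA:
  assumes "1 \<le> k"
  shows "mc \<xi> < fastA k \<xi>"
proof (induction \<xi> rule: less_induct)
  case (less \<xi>)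
  show ?case
  proof (cases "lim_part \<xi> = 0")
    case True
    then show ?thesis using mc_finite[OF True] by (simp add: fastA_finite)
  next
    case False
    have "x < fastA k (fs (lim_part \<xi>) x)" for x
      using less[of "fs (lim_part \<xi>) x", OF less_le_trans[OF fs_less[OF False, of x] lim_part_le[of \<xi>]]]
        le_mc_fs[of "lim_part \<xi>" x] lim_part_limit[of \<xi>] False by auto
    note it = iterate_ge[of "\<lambda>x. fastA k (fs (lim_part \<xi>) x)" _ k, OF this]
    show ?thesis
    proof (cases "fin_part \<xi> > 0")
      case True
      then show ?thesis
        using it[of "fastA k (lim_part \<xi> + nat_e0 (fin_part \<xi> - 1))"] mc_pred[OF True] assms
          less[OF lim_part_pred_less[OF True]]
        unfolding fastA_infinite[OF False, of k] by simp
    next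
      case 2: False
      then show ?thesis using it[of "mc \<xi>"] assms unfolding fastA_infinite[OF False, of k] by simp
    qed
  qed
qed

primrec ht_cnf :: "cnf \<Rightarrow> nat" where
  "ht_cnf Z = 0"
| "ht_cnf (W a b c) = max (Suc (ht_cnf a)) (ht_cnf c)"

lift_definition ht :: "e0 \<Rightarrow> nat" is ht_cnf .

lemma ht_fs: "0 < n \<Longrightarrow> ht \<alpha> \<le> Suc (ht (fs \<alpha> n))"
proof transfer
  show "0 < n \<Longrightarrow> nf x \<Longrightarrow> ht_cnf x \<le> Suc (ht_cnf (fs_cnf x n))" for n x
  proof (induction x n rule: fs_cnf.induct)
    case (2 a b c n)
    then show ?case by (cases "c = Z") (auto simp: Let_def)
  qed simp
qed

lemma ht_lim_part: "ht \<xi> \<le> max 1 (ht (lim_part \<xi>))"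
proof transfer
  show "nf x \<Longrightarrow> ht_cnf x \<le> max 1 (ht_cnf (lim_cnf x))" for x
    by (induction x) (auto simp: less_W1_nf)
qed

lemma ht_le_fastA:
  assumes "2 \<le> k"
  shows "ht \<xi> \<le> fastA k \<xi>"
proof (induction \<xi> rule: less_induct)
  case (less \<xi>)
  show ?case
  proof (cases "lim_part \<xi> = 0")
    case True
    have "ht 0 = 0" by transfer simp
    then show ?thesis using ht_lim_part[of \<xi>] True by (simp add: fastA_finite)
  next
    case False
    define f where "f = (\<lambda>x. fastA k (fs (lim_part \<xi>) x))"
    have f: "x < f x" for x
      using mc_less_fastA[of k "fs (lim_part \<xi>) x"] assms
        le_mc_fs[of "lim_part \<xi>" x] lim_part_limit[of \<xi>] False by (auto simp: f_def)
    have fh: "ht (lim_part \<xi>) \<le> Suc (f x)" if "0 < x" for x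
      using less[of "fs (lim_part \<xi>) x", OF less_le_trans[OF fs_less[OF False, of x] lim_part_le[of \<xi>]]]
        ht_fs[OF that, of "lim_part \<xi>"]
      by (auto simp: f_def)
    obtain j where k: "k = Suc (Suc j)" using assms by (metis add_2_eq_Suc le_Suc_ex)
    have pos: "0 < (f ^^ j) s" if "0 < s" for s using iterate_ge[of f s j, OF f] that by simp
    have "ht (lim_part \<xi>) \<le> (f ^^ k) s \<and> 1 \<le> (f ^^ k) s" if "0 < s" for s
      using fh[OF pos[OF that]] f[of "f ((f ^^ j) s)"] by (simp add: k)
    moreover have "0 < (if fin_part \<xi> > 0 then fastA k (lim_part \<xi> + nat_e0 (fin_part \<xi> - 1)) else mc \<xi>)"
    proof -
      have "\<xi> \<noteq> 0" using False lim_part_le[of \<xi>] by (metis less_eq_e0.rep_eq zero_e0.rep_eq Z_le Rep_e0_inject antisym)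
      then have "0 < mc \<xi>" using mc_nf_parts(3,4)[of \<xi>] by simp
      then show ?thesis using mc_less_fastA[of k "lim_part \<xi> + nat_e0 (fin_part \<xi> - 1)"] assms by auto
    qed
    ultimately have "ht (lim_part \<xi>) \<le> fastA k \<xi> \<and> 1 \<le> fastA k \<xi>"
      unfolding fastA_infinite[OF False, of k] f_def[symmetric] by blast
    then show ?thesis using ht_lim_part[of \<xi>] by auto
  qed
qed

primrec tops :: "cnf \<Rightarrow> cnf set" where
  "tops Z = {}"
| "tops (W a b c) = insert a (tops c)"

lemma tops_less: "nf (W a b c) \<Longrightarrow> a' \<in> tops c \<Longrightarrow> a' < a"
proof (induction c arbitrary: a b)
  case (W a2 b2 c2)
  have "a2 < a" using W.prems by (auto simp: less_W1_nf)
  then show ?case using W.prems W.IH(2)[of a2 b2] by auto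
qed simp

lemma finite_tops:
  "finite E \<Longrightarrow> finite {x. nf x \<and> tops x \<subseteq> E \<and> coeffs_cnf x \<subseteq> {..m}}"
proof (induction "card E" arbitrary: E rule: less_induct)
  case less
  define F where "F = (\<lambda>E. {x. nf x \<and> tops x \<subseteq> E \<and> coeffs_cnf x \<subseteq> {..m}})"
  have fin: "finite (F {e \<in> E. e < a})" if "a \<in> E" for a
  proof -
    have "{e \<in> E. e < a} \<subset> E" using that by auto
    then show ?thesis unfolding F_def using less by (intro less(1)) (auto intro: psubset_card_mono)
  qed
  have "F E \<subseteq> insert Z (\<Union>a\<in>E. \<Union>b\<in>{..m}. W a b ` F {e \<in> E. e < a})"
  proof
    fix x assume x: "x \<in> F E"
    show "x \<in> insert Z (\<Union>a\<in>E. \<Union>b\<in>{..m}. W a b ` F {e \<in> E. e < a})"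
    proof (cases x)
      case (W a b c)
      then have "c \<in> F {e \<in> E. e < a}" using x tops_less[of a b c] by (auto simp: F_def)
      then show ?thesis using x W by (auto simp: F_def)
    qed simp
  qed
  then have "finite (F E)" by (rule finite_subset) (use fin less.prems in auto)
  then show ?case by (simp add: F_def)
qed

lemma finite_ht: "finite {x. nf x \<and> ht_cnf x \<le> h \<and> coeffs_cnf x \<subseteq> {..m}}" (is "finite (?S h)")
proof (induction h)
  case 0
  have "ht_cnf x \<le> 0 \<longleftrightarrow> x = Z" for x by (cases x) auto
  then have "?S 0 \<subseteq> {Z}" by blast
  then show ?case by (rule finite_subset) simp
next
  case (Suc h)
  have "tops x \<subseteq> ?S h" if "x \<in> ?S (Suc h)" for x
    using that by (induction x) auto
  then have "?S (Suc h) \<subseteq> {x. nf x \<and> tops x \<subseteq> ?S h \<and> coeffs_cnf x \<subseteq> {..m}}" by blast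
  then show ?case using finite_tops[OF Suc] by (rule finite_subset)
qed

lemma finite_fastA_le:
  assumes "2 \<le> k"
  shows "finite {\<zeta>. fastA k \<zeta> \<le> m}"
proof -
  have "Rep_e0 \<zeta> \<in> {x. nf x \<and> ht_cnf x \<le> m \<and> coeffs_cnf x \<subseteq> {..m}}" if "fastA k \<zeta> \<le> m" for \<zeta>
    using that Rep_e0[of \<zeta>] ht_le_fastA[OF assms, of \<zeta>] mc_less_fastA[of k \<zeta>] assms
      coeffs_le_mc[of _ \<zeta>] by (fastforce simp: ht.rep_eq coeffs.rep_eq)
  then have "Rep_e0 ` {\<zeta>. fastA k \<zeta> \<le> m} \<subseteq> {x. nf x \<and> ht_cnf x \<le> m \<and> coeffs_cnf x \<subseteq> {..m}}"
    by blast
  then have "finite (Rep_e0 ` {\<zeta>. fastA k \<zeta> \<le> m})" using finite_ht finite_subset by blast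
  then show ?thesis by (rule finite_imageD) (simp add: inj_on_def Rep_e0_inject)
qed


section \<open>\<open>k\<close>-normal forms\<close>

text \<open>\<open>knf_next k m \<xi>\<^sub>i\<close> is \<open>\<xi>\<^sub>i\<^sub>+\<^sub>1\<close>, and \<open>knf k m \<xi>\<close> is \<open>m \<equiv>\<^sub>k A\<^sub>k(\<xi>)\<close>.\<close>

definition knf_next :: "nat \<Rightarrow> nat \<Rightarrow> e0 \<Rightarrow> e0" where
  "knf_next k m \<xi> =
     (let P = (\<lambda>\<zeta>. fastA k \<zeta> \<le> m \<and> mc \<zeta> \<ge> fastA k \<xi>)
      in if \<exists>\<zeta>. P \<zeta> \<and> (\<forall>\<zeta>'. P \<zeta>' \<longrightarrow> \<zeta>' \<le> \<zeta>) then (GREATEST \<zeta>. P \<zeta>) else 0)"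

definition knf :: "nat \<Rightarrow> nat \<Rightarrow> e0 \<Rightarrow> bool" where
  "knf k m \<xi> \<longleftrightarrow> 0 < m \<and> m = fastA k \<xi> \<and>
     (\<exists>n s. s 0 = 0 \<and> s n = \<xi> \<and> (\<forall>i<n. s (Suc i) = knf_next k m (s i)))"

lemma fastA_0: "fastA k 0 = 1"
proof -
  have "lim_part 0 = 0" "fin_part 0 = 0" by (transfer, simp)+
  then show ?thesis by (simp add: fastA_finite)
qed

lemma knf_next_less:
  assumes "2 \<le> k" "fastA k \<xi> < m"
  shows "fastA k (knf_next k m \<xi>) \<le> m" "fastA k \<xi> < fastA k (knf_next k m \<xi>)"
proof -
  define P where "P = (\<lambda>\<zeta>. fastA k \<zeta> \<le> m \<and> mc \<zeta> \<ge> fastA k \<xi>)"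
  have "finite {\<zeta>. P \<zeta>}"
    by (rule finite_subset[OF _ finite_fastA_le[OF assms(1), of m]]) (auto simp: P_def)
  moreover have "P (nat_e0 (fastA k \<xi>))"
  proof -
    have "lim_part (nat_e0 n) = 0 \<and> fin_part (nat_e0 n) = n" for n
      using lim_part_unique[of 0 n] by simp
    moreover have "n \<in> coeffs (nat_e0 n)" for n unfolding nat_e0_def by transfer simp
    ultimately show ?thesis using assms(2) coeffs_le_mc by (simp add: P_def fastA_finite)
  qed
  ultimately have max: "P (Max {\<zeta>. P \<zeta>}) \<and> (\<forall>\<zeta>'. P \<zeta>' \<longrightarrow> \<zeta>' \<le> Max {\<zeta>. P \<zeta>})"
    using Max_in[of "{\<zeta>. P \<zeta>}"] Max_ge[of "{\<zeta>. P \<zeta>}"] by blast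
  then have "knf_next k m \<xi> = (GREATEST \<zeta>. P \<zeta>)"
    unfolding knf_next_def P_def[symmetric] Let_def by auto
  also have "\<dots> = Max {\<zeta>. P \<zeta>}" using max by (intro Greatest_equality) auto
  finally have "P (knf_next k m \<xi>)" using max by simp
  then show "fastA k (knf_next k m \<xi>) \<le> m" "fastA k \<xi> < fastA k (knf_next k m \<xi>)"
    using mc_less_fastA[of k "knf_next k m \<xi>"] assms(1) by (auto simp: P_def)
qed

lemma knf_next_final:
  assumes "1 \<le> k" "m \<le> fastA k \<xi>"
  shows "knf_next k m \<xi> = 0"
proof -
  have "\<not> (fastA k \<zeta> \<le> m \<and> mc \<zeta> \<ge> fastA k \<xi>)" for \<zeta>
    using mc_less_fastA[OF assms(1), of \<zeta>] assms(2) by simp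
  then show ?thesis unfolding knf_next_def Let_def by (subst if_not_P) blast+
qed

lemma knf_ex1:
  assumes "2 \<le> k" "0 < m"
  shows "\<exists>!\<xi>. knf k m \<xi>"
proof -
  define s where "s = (\<lambda>i. (knf_next k m ^^ i) 0)"
  have s0: "s 0 = 0" and sS: "s (Suc i) = knf_next k m (s i)" for i by (simp_all add: s_def)
  have knf: "knf k m \<xi> \<longleftrightarrow> m = fastA k \<xi> \<and> (\<exists>n. s n = \<xi>)" for \<xi>
  proof -
    have "t i = s i" if "t 0 = 0" "\<forall>i<n. t (Suc i) = knf_next k m (t i)" "i \<le> n" for t n i
      using that(3) by (induction i) (use that s0 sS in auto)
    then have "(\<exists>n t. t 0 = 0 \<and> t n = \<xi> \<and> (\<forall>i<n. t (Suc i) = knf_next k m (t i))) \<longleftrightarrow> (\<exists>n. s n = \<xi>)"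
      using s0 sS by (metis order_refl)
    then show ?thesis using assms(2) by (simp add: knf_def)
  qed
  have le: "fastA k (s i) \<le> m" for i
  proof (induction i)
    case (Suc i)
    then show ?case
      using knf_next_less(1)[OF assms(1), of "s i" m] knf_next_final[of k m "s i"] assms
      by (cases "fastA k (s i) < m") (auto simp: sS fastA_0)
  qed (use assms in \<open>simp add: s0 fastA_0\<close>)
  have "\<exists>i. fastA k (s i) = m"
  proof (rule ccontr)
    assume "\<not> ?thesis"
    then have lt: "fastA k (s i) < m" for i using le[of i] by (simp add: le_less)
    have "i \<le> fastA k (s i)" for i
    proof (induction i)
      case (Suc i)
      then show ?case using knf_next_less(2)[OF assms(1) lt[of i]] by (simp add: sS)
    qed simp
    then show False using lt[of m] by (simp add: leD)
  qed
  then obtain N where N: "fastA k (s N) = m" "\<And>i. i < N \<Longrightarrow> fastA k (s i) \<noteq> m"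
    using exists_least_iff[of "\<lambda>i. fastA k (s i) = m"] by auto
  have "\<exists>j\<le>N. s i = s j" for i
  proof (induction i)
    case (Suc i)
    then obtain j where j: "j \<le> N" "s i = s j" by blast
    show ?case
    proof (cases "j = N")
      case True
      then have "s (Suc i) = s 0" using j N(1) knf_next_final[of k m "s N"] assms by (simp add: sS s0)
      then show ?thesis by blast
    next
      case False
      then have "s (Suc i) = s (Suc j)" "Suc j \<le> N" using j by (simp_all add: sS)
      then show ?thesis by blast
    qed
  qed auto
  then have uniq: "s i = s N" if "fastA k (s i) = m" for i
    using that N by (metis le_neq_implies_less)
  show ?thesis
  proof (rule ex1I)
    show "knf k m (s N)" unfolding knf using N(1) by blast
    show "\<xi> = s N" if "knf k m \<xi>" for \<xi>
      using that uniq unfolding knf by blast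
  qed
qed


section \<open>Base change and the fast Goodstein sequence\<close>

text \<open>
  Only finite target bases \<open>\<lambda> = l\<close> are needed, so that \<open>\<kappa> = \<omega>\<close>. The guard \<open>k < 2\<close> only makes
  the recursion total; the base change is meant for \<open>2 \<le> k < l\<close>.
\<close>

function base_change_nat :: "nat \<Rightarrow> nat \<Rightarrow> nat \<Rightarrow> nat"
  and base_change_e0 :: "nat \<Rightarrow> nat \<Rightarrow> e0 \<Rightarrow> e0" where
  "base_change_nat k l m =
     (if m = 0 \<or> k < 2 then 0 else fastA l (base_change_e0 k l (THE \<xi>. knf k m \<xi>)))"
| "base_change_e0 k l \<xi> =
     (if \<xi> = 0 then 0
      else omega_mult (base_change_e0 k l (nf_exp \<xi>)) (base_change_nat k l (nf_coeff \<xi>))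
           + base_change_e0 k l (nf_rem \<xi>))"
  by pat_completeness auto
termination
proof (relation "inv_image (less_than <*lex*> less_than)
    (case_sum (\<lambda>(k, l, m). (m, 0)) (\<lambda>(k, l, \<xi>). (mc \<xi>, Suc (size (Rep_e0 \<xi>)))))", goal_cases)
  case 1
  show ?case by (intro wf_inv_image wf_lex_prod wf_less_than)
next
  case (2 k l m)
  then have "knf k m (THE \<xi>. knf k m \<xi>)" using theI'[OF knf_ex1[of k m]] by simp
  then have "m = fastA k (THE \<xi>. knf k m \<xi>)" by (subst (asm) knf_def) blast
  then have "mc (THE \<xi>. knf k m \<xi>) < m" using mc_less_fastA[of k "THE \<xi>. knf k m \<xi>"] 2 by simp
  then show ?case by simp
next
  case (3 k l \<xi>)
  have "size (Rep_e0 (nf_exp \<xi>)) < size (Rep_e0 \<xi>)"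
    using 3 by transfer (case_tac \<xi>; auto)
  then show ?case using mc_nf_parts[OF 3] by auto
next
  case (4 k l \<xi>)
  then show ?case using mc_nf_parts[OF 4] by auto
next
  case (5 k l \<xi>)
  have "size (Rep_e0 (nf_rem \<xi>)) < size (Rep_e0 \<xi>)"
    using 5 by transfer (case_tac \<xi>; auto)
  then show ?case using mc_nf_parts[OF 5] by auto
qed

declare base_change_nat.simps [simp del] base_change_e0.simps [simp del]

lemma base_change_knf:
  assumes "2 \<le> k" "knf k m \<xi>"
  shows "base_change_nat k l m = fastA l (base_change_e0 k l \<xi>)"
proof -
  have "0 < m" using assms(2) by (simp add: knf_def)
  then have "(THE \<xi>. knf k m \<xi>) = \<xi>" using knf_ex1[OF assms(1)] assms(2) by (blast intro: the1_equality)
  then show ?thesis using \<open>0 < m\<close> assms(1) by (subst base_change_nat.simps) simp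
qed

lemma base_change_nf:
  assumes "is_nf \<xi> \<alpha> b \<gamma>"
  shows "base_change_e0 k l \<xi> =
    omega_mult (base_change_e0 k l \<alpha>) (base_change_nat k l b) + base_change_e0 k l \<gamma>"
proof -
  have "\<xi> \<noteq> 0" using assms unfolding is_nf_def by transfer auto
  then show ?thesis using assms omega_normal_form[of \<xi>] by (subst base_change_e0.simps) simp
qed

text \<open>After reaching \<open>0\<close>, where the sequence stops, its value is kept at \<open>0\<close>.\<close>

primrec fast_goodstein :: "nat \<Rightarrow> nat \<Rightarrow> nat" where
  "fast_goodstein m 0 = m"
| "fast_goodstein m (Suc i) =
     (if fast_goodstein m i > 0
      then base_change_nat (i + 2) (i + 3) (fast_goodstein m i) - 1
      else 0)"

end

theory Submission
  imports Defs
begin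

text \<open>
  Writing the \<open>k\<close>-normal form of a number hereditarily yields a tree, and base change leaves this
  tree unchanged because it preserves normal forms, while subtracting \<open>1\<close> makes the tree smaller in
  the order induced by \<open>A\<^sub>\<omega>\<close>. That order is well-founded by an impredicative argument:
  ordinals below \<open>\<epsilon>\<^sub>\<Omega>\<^sub>+\<^sub>1\<close> whose coefficients lie in the accessible part of the collapsed
  order are well-ordered, and by induction along them their collapses are accessible as well.

  Preservation of normal forms amounts to the maximality of each \<open>\<xi>\<^sub>i\<^sub>+\<^sub>1\<close> after base change from
  \<open>k\<close> to \<open>l\<close>. For a larger competitor with limit part \<open>\<alpha>'\<close>, either a member of the fundamental
  sequence of \<open>\<alpha>'\<close> is a smaller competitor, or \<open>\<alpha>'\<close> arises by truncating and incrementing the base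
  change of \<open>\<xi>\<^sub>i\<^sub>+\<^sub>1\<close>. In the latter case the iterates defining \<open>A\<^sub>l\<close> dominate the base change of the
  corresponding iterates defining \<open>A\<^sub>k\<close>; the errors made on the way cost at most the additional
  iterations allowed by \<open>k < l\<close>.
\<close>

section \<open>Order and coefficients of fundamental sequences\<close>

lemma W_le_iff [simp]: "W a b c \<le> W a' b' c' \<longleftrightarrow> a < a' \<or> a = a' \<and> (b < b' \<or> b = b' \<and> c \<le> c')"
  by (auto simp: less_eq_cnf_def)

lemma le_Z_iff [simp]: "x \<le> Z \<longleftrightarrow> x = Z"
  by (auto simp: less_eq_cnf_def)

text \<open>The structurally recursive form of \<open>mc\<close>, suited to induction;
  \<open>mc_transfer\<close> makes it available to \<open>transfer\<close>.\<close>

primrec mcc :: "cnf \<Rightarrow> nat" where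
  "mcc Z = 0"
| "mcc (W a b c) = max b (max (mcc a) (mcc c))"

lemma mcc_eq_Max: "mcc x = Max (coeffs_cnf x)"
proof (induction x)
  case (W a b c)
  have ne: "coeffs_cnf x \<noteq> {}" for x using zero_in_coeffs_cnf by blast
  have "Max (coeffs_cnf a \<union> coeffs_cnf c \<union> {b}) = max (Max (coeffs_cnf a)) (max (Max (coeffs_cnf c)) b)"
    using ne by (simp add: Max_Un)
  then show ?case using W by simp
qed simp

lemma mc_transfer [transfer_rule]: "rel_fun pcr_e0 (=) mcc mc"
  by (auto simp: rel_fun_def e0.pcr_cr_eq cr_e0_def mc_def mcc_eq_Max coeffs.rep_eq)

text \<open>For a successor \<open>x\<close> the value \<open>fs_cnf x n\<close> is its predecessor,
  whatever \<open>n\<close> is. This later pins down exponents that lie just below a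
  successor.\<close>

lemma fs_cnf_pred_ge:
  assumes "nf x" "nf z" "0 < fin_cnf x" "z < x"
  shows "z \<le> fs_cnf x n"
  using assms
proof (induction x arbitrary: z)
  case (W a b c)
  show ?case
  proof (cases "c = Z")
    case True
    then have "a = Z" using W.prems by (auto split: if_splits)
    then show ?thesis using True W.prems
      by (cases z) (auto simp: less_W1_nf le_less)
  next
    case False
    then have "a \<noteq> Z" using W.prems by (auto simp: less_W1_nf)
    then show ?thesis using False W.prems W.IH(2)
      by (cases z) (auto simp: le_less)
  qed
qed simp

text \<open>Cofinality with an explicit index: at the place where \<open>x\<close> is lowered, the
  new coefficient \<open>n\<close> outweighs every coefficient of \<open>z\<close>; a limit exponent
  is handled by recursion.\<close>

lemma less_fs_cnf:
  assumes "nf x" "nf z" "fin_cnf x = 0" "z < x" "mcc z < n"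
  shows "z < fs_cnf x n"
  using assms
proof (induction x n arbitrary: z rule: fs_cnf.induct)
  case (2 a b c n)
  note prems = "2.prems"
  have a: "a \<noteq> Z" using prems by auto
  show ?case
  proof (cases "c = Z")
    case False
    then show ?thesis using prems "2.IH"(1) a
      by (cases z) auto
  next
    case True
    \<comment> \<open>\<open>d\<close> is the \<open>n\<close>-th member for the single power with
      exponent \<open>a\<close>; the branch \<open>n = 0\<close> of \<open>fs_cnf\<close> is
      excluded by \<open>mcc z < n\<close>.\<close>
    define d where "d = (if fin_cnf a > 0 then W (fs_cnf a n) n Z else W (fs_cnf a n) 1 Z)"
    have n: "0 < n" using prems by simp
    have d: "y < d" if y: "nf y" "y < W a 1 Z" "mcc y < n" for y
    proof (cases y)
      case Z
      then show ?thesis by (simp add: d_def)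
    next
      case (W a' b' c')
      have a': "nf a'" "a' < a" "mcc a' < n" "b' < n" using y W prems by (auto simp: less_W1_nf)
      show ?thesis
      proof (cases "fin_cnf a > 0")
        case True
        then show ?thesis using fs_cnf_pred_ge[of a a' n] a' prems W by (auto simp: d_def le_less)
      next
        case False
        then show ?thesis using "2.IH"(3)[of a'] True a a' n prems W by (auto simp: d_def)
      qed
    qed
    have eq: "fs_cnf (W a b c) n = (if b = 1 then d else W a (b - 1) d)"
      using True a n by (simp add: d_def)
    show ?thesis
    proof (cases z)
      case Z
      then show ?thesis using eq by (simp add: d_def)
    next
      case (W a' b' c')
      then show ?thesis using prems d[of z] d[of c'] unfolding eq by (auto simp: True)
    qed
  qed
qed simp

text \<open>A norm version of the Bachmann property: \<open>z\<close> can only enlarge or extend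
  what \<open>fs_cnf x n\<close> has at the place where \<open>x\<close> is lowered.\<close>

lemma mcc_fs_cnf_between:
  assumes "nf x" "nf z" "fin_cnf x = 0" "fs_cnf x n < z" "z < x"
  shows "mcc (fs_cnf x n) \<le> mcc z"
  using assms
proof (induction x n arbitrary: z rule: fs_cnf.induct)
  case (2 a b c n)
  note prems = "2.prems"
  have a: "a \<noteq> Z" using prems by auto
  show ?case
  proof (cases "c = Z")
    case False
    have *: "fs_cnf (W a b c) n = W a b (fs_cnf c n)" using False by simp
    obtain z' where z': "z = W a b z'" "fs_cnf c n < z'" "z' < c"
      using prems unfolding * by (cases z) auto
    then show ?thesis using "2.IH"(1)[of z'] False prems a by auto
  next
    case True
    define d where "d = (if fin_cnf a > 0 then (if n = 0 then Z else W (fs_cnf a n) n Z) else W (fs_cnf a n) 1 Z)"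
    have d: "mcc d \<le> mcc y" if y: "nf y" "y < W a 1 Z" "d < y" for y
    proof (cases y)
      case Z
      then show ?thesis using y by simp
    next
      case (W a' b' c')
      have a': "nf a'" "a' < a" "0 < b'" using y W prems by (auto simp: less_W1_nf)
      show ?thesis
      proof (cases "fin_cnf a > 0")
        case True
        then show ?thesis using fs_cnf_pred_ge[of a a' n] a' prems W y by (auto simp: d_def split: if_splits)
      next
        case False
        then have d': "d = W (fs_cnf a n) 1 Z" using a by (simp add: d_def)
        then have "fs_cnf a n = a' \<or> fs_cnf a n < a'" using y(3) unfolding W by auto
        then have "mcc (fs_cnf a n) \<le> mcc a'"
          using "2.IH"(3)[of a'] \<open>c = Z\<close> a a' prems(1) False by auto
        then show ?thesis using a'(3) unfolding W d' mcc.simps by linarith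
      qed
    qed
    have eq: "fs_cnf (W a b c) n = (if b = 1 then d else W a (b - 1) d)"
      using True a by (simp add: d_def)
    show ?thesis
    proof (cases "b = 1")
      case True
      then show ?thesis using prems d[of z] \<open>c = Z\<close> unfolding eq by simp
    next
      case False
      obtain z' where "z = W a (b - 1) z'" "d < z'" 
        using prems False \<open>c = Z\<close> unfolding eq by (cases z) auto
      then show ?thesis using False d[of z'] prems unfolding eq by auto
    qed
  qed
qed simp

lemma fs_cnf_pred_const: "nf x \<Longrightarrow> 0 < fin_cnf x \<Longrightarrow> fs_cnf x n = fs_cnf x n'"
proof (induction x)
  case (W a b c)
  then show ?case by (cases "c = Z") (auto simp: less_W1_nf split: if_splits)
qed simp

lemma fs_cnf_mono: "nf x \<Longrightarrow> n \<le> n' \<Longrightarrow> fs_cnf x n \<le> fs_cnf x n'"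
proof (induction x)
  case (W a b c)
  show ?case
  proof (cases "c = Z")
    case False
    then show ?thesis using W by simp
  next
    case True
    define d where "d n = (if a = Z then Z else if fin_cnf a > 0 then (if n = 0 then Z else W (fs_cnf a n) n Z) else W (fs_cnf a n) 1 Z)" for n
    have "d n \<le> d n'"
    proof (cases "fin_cnf a > 0")
      case True
      then show ?thesis using W fs_cnf_pred_const[of a n n'] by (auto simp: d_def)
    next
      case False
      then have "fs_cnf a n < fs_cnf a n' \<or> fs_cnf a n = fs_cnf a n'" using W by (simp add: le_less)
      then show ?thesis using False by (simp add: d_def)
    qed
    moreover have "fs_cnf (W a b c) n = (if b = 1 then d n else W a (b - 1) (d n))" for n
      using True by (simp add: d_def)
    ultimately show ?thesis by simp
  qed
qed simp

lemma mcc_lim_fin: "nf x \<Longrightarrow> mcc x = max (mcc (lim_cnf x)) (fin_cnf x)"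
proof (induction x)
  case (W a b c)
  show ?case
  proof (cases "a = Z")
    case True
    then show ?thesis using W.prems by (auto simp: less_W1_nf)
  next
    case False
    then have "mcc c = max (mcc (lim_cnf c)) (fin_cnf c)" using W by simp
    then show ?thesis using False by (simp add: max.assoc)
  qed
qed simp

lemma less_iff_fin_cnf:
  "nf x \<Longrightarrow> nf y \<Longrightarrow> lim_cnf x = lim_cnf y \<Longrightarrow> x < y \<longleftrightarrow> fin_cnf x < fin_cnf y"
proof (induction x arbitrary: y)
  case Z
  then show ?case by (cases y) (auto split: if_splits)
next
  case (W a b c)
  then show ?case by (cases y) (auto simp: less_W1_nf split: if_splits)
qed

lemma lim_cnf_mono: "nf x \<Longrightarrow> nf y \<Longrightarrow> x \<le> y \<Longrightarrow> lim_cnf x \<le> lim_cnf y"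
proof (induction x arbitrary: y)
  case (W a b c)
  then show ?case by (cases y) (auto simp: le_less less_W1_nf)
qed simp

lemma lim_cnf_idem: "lim_cnf (lim_cnf x) = lim_cnf x"
  by (induction x) auto

section \<open>Changing coefficients\<close>

primrec map_coeffs :: "(nat \<Rightarrow> nat) \<Rightarrow> cnf \<Rightarrow> cnf" where
  "map_coeffs u Z = Z"
| "map_coeffs u (W a b c) = W (map_coeffs u a) (u b) (map_coeffs u c)"

lemma map_coeffs_eq_Z [simp]: "map_coeffs u x = Z \<longleftrightarrow> x = Z"
  by (cases x) auto

text \<open>\<open>u\<close> stands for base change on numbers and \<open>U\<close> for base change
  on ordinals. Fixing 1 makes powers of \<omega> go to powers of \<omega>.\<close>

locale coeff_map =
  fixes u :: "nat \<Rightarrow> nat"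
  assumes strict_mono_u: "strict_mono u" and u_0 [simp]: "u 0 = 0" and u_1 [simp]: "u (Suc 0) = Suc 0"
begin

lemma u_less_iff [simp]: "u x < u y \<longleftrightarrow> x < y"
  using strict_mono_u by (simp add: strict_mono_less)

lemma u_le_iff [simp]: "u x \<le> u y \<longleftrightarrow> x \<le> y"
  using strict_mono_u by (simp add: strict_mono_less_eq)

lemma u_eq_iff [simp]: "u x = u y \<longleftrightarrow> x = y"
  using strict_mono_u by (simp add: strict_mono_eq)

lemma u_eq_0_iff [simp]: "u x = 0 \<longleftrightarrow> x = 0"
  using u_eq_iff[of x 0] by (simp del: u_eq_iff)

lemma u_eq_1_iff [simp]: "u x = Suc 0 \<longleftrightarrow> x = Suc 0"
  using u_eq_iff[of x "Suc 0"] by (simp del: u_eq_iff)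

lemma u_pos_iff [simp]: "0 < u x \<longleftrightarrow> 0 < x"
  using u_less_iff[of 0 x] by (simp del: u_less_iff)

lemma le_u: "x \<le> u x"
  using strict_mono_u by (simp add: strict_mono_imp_increasing)

lemma Suc_u_le: "Suc (u x) \<le> u (Suc x)"
  by (simp add: Suc_le_eq)

lemma u_max: "u (max x y) = max (u x) (u y)"
  by (simp add: max_def)

abbreviation "U \<equiv> map_coeffs u"

lemma U_eq_iff [simp]: "U x = U y \<longleftrightarrow> x = y"
proof (induction x arbitrary: y)
  case (W a b c)
  then show ?case by (cases y) auto
qed (metis map_coeffs_eq_Z)

lemma U_less_iff [simp]: "U x < U y \<longleftrightarrow> x < y"
proof (induction x arbitrary: y)
  case Z
  then show ?case by (cases y) auto
next
  case (W a b c)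
  then show ?case by (cases y) auto
qed

lemma U_le_iff [simp]: "U x \<le> U y \<longleftrightarrow> x \<le> y"
  by (simp add: le_less)

lemma nf_U [simp]: "nf x \<Longrightarrow> nf (U x)"
proof (induction x)
  case (W a b c)
  then show ?case by (auto simp: less_W1_nf)
qed simp

lemma mcc_U: "mcc (U x) = u (mcc x)"
  by (induction x) (auto simp: u_max)

lemma lim_cnf_U: "lim_cnf (U x) = U (lim_cnf x)"
  by (induction x) auto

lemma fin_cnf_U [simp]: "fin_cnf (U x) = u (fin_cnf x)"
  by (induction x) auto

text \<open>Equality can fail only where a coefficient is decremented, as \<open>u (b - 1)\<close>
  may be less than \<open>u b - 1\<close>. Order and maximal coefficient are both tracked because
  \<open>fastA_mono\<close> asks for both.\<close>

lemma U_fs_cnf_le: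
  "nf x \<Longrightarrow> U (fs_cnf x n) \<le> fs_cnf (U x) (u n) \<and> mcc (U (fs_cnf x n)) \<le> mcc (fs_cnf (U x) (u n))"
proof (induction x)
  case (W a b c)
  show ?case
  proof (cases "c = Z")
    case False
    then have "U (fs_cnf c n) \<le> fs_cnf (U c) (u n)" "mcc (U (fs_cnf c n)) \<le> mcc (fs_cnf (U c) (u n))"
      using W by simp_all
    then show ?thesis using False by auto
  next
    case True
    define d where "d = (if a = Z then Z else if fin_cnf a > 0 then (if n = 0 then Z else W (fs_cnf a n) n Z) else W (fs_cnf a n) 1 Z)"
    define d' where "d' = (if U a = Z then Z else if fin_cnf (U a) > 0 then (if u n = 0 then Z else W (fs_cnf (U a) (u n)) (u n) Z) else W (fs_cnf (U a) (u n)) 1 Z)"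
    have d: "U d \<le> d' \<and> mcc (U d) \<le> mcc d'"
    proof (cases "a = Z")
      case False
      then have "U (fs_cnf a n) \<le> fs_cnf (U a) (u n)" "mcc (U (fs_cnf a n)) \<le> mcc (fs_cnf (U a) (u n))"
        using W by simp_all
      moreover from this(1) have "U (fs_cnf a n) < fs_cnf (U a) (u n) \<or> U (fs_cnf a n) = fs_cnf (U a) (u n)"
        by (simp add: le_less)
      ultimately show ?thesis using False unfolding d_def d'_def by auto
    qed (simp add: d_def d'_def)
    have eq: "fs_cnf (W a b c) n = (if b = 1 then d else W a (b - 1) d)"
      using True by (simp add: d_def)
    have eq': "fs_cnf (U (W a b c)) (u n) = (if b = 1 then d' else W (U a) (u b - 1) d')"
      using True by (simp add: d'_def)
    have "u (b - 1) \<le> u b - 1" using Suc_u_le[of "b - 1"] W by simp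
    then have "max (u (b - 1)) (max (mcc (U a)) (mcc (U d))) \<le> max (u b - 1) (max (mcc (U a)) (mcc d'))"
      using d by (intro max.mono) auto
    moreover have "W (U a) (u (b - 1)) (U d) \<le> W (U a) (u b - 1) d'"
      using d \<open>u (b - 1) \<le> u b - 1\<close> by auto
    ultimately show ?thesis unfolding eq eq' using d by simp
  qed
qed simp

end

section \<open>Limits just above the image of a coefficient map\<close>

lemma lim_fin_fs_cnf:
  "nf x \<Longrightarrow> 0 < fin_cnf x \<Longrightarrow> lim_cnf (fs_cnf x n) = lim_cnf x \<and> fin_cnf x = Suc (fin_cnf (fs_cnf x n))"
proof (induction x)
  case (W a b c)
  show ?case
  proof (cases "c = Z")
    case True
    then show ?thesis using W.prems by (auto split: if_splits)
  next
    case False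
    then have "a \<noteq> Z" using W.prems by (auto simp: less_W1_nf)
    then show ?thesis using W False by auto
  qed
qed simp

text \<open>\<open>u\<close> need not commute with the successor, so a coefficient that is one more than \<open>u y\<close> is
  matched only up to an error of one.\<close>

definition near :: "(nat \<Rightarrow> nat) \<Rightarrow> nat \<Rightarrow> nat \<Rightarrow> bool" where
  "near u a' a \<longleftrightarrow> (\<forall>y. u y \<le> a' \<longrightarrow> y \<le> a) \<and> (\<exists>y. u y \<le> a' \<and> a \<le> Suc y)"

context coeff_map
begin

lemma near_u: "near u (u a) a"
  by (auto simp: near_def)

lemma near_Suc: "near u (Suc (u a)) (Suc a)"
proof -
  have "y \<le> Suc a" if "u y \<le> Suc (u a)" for y
  proof (rule ccontr)
    assume "\<not> y \<le> Suc a"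
    then have "u (Suc a) < u y" by simp
    then show False using Suc_u_le[of a] that by linarith
  qed
  then show ?thesis by (auto simp: near_def intro!: exI[of _ a])
qed

lemma near_max:
  assumes "near u a' a" "near u b' b"
  shows "near u (max a' b') (max a b)"
proof -
  obtain y z where "u y \<le> a'" "a \<le> Suc y" "u z \<le> b'" "b \<le> Suc z"
    using assms by (auto simp: near_def)
  then have "u (max y z) \<le> max a' b' \<and> max a b \<le> Suc (max y z)"
    by (auto simp: u_max)
  then show ?thesis using assms unfolding near_def by (auto simp: le_max_iff_disj)
qed

text \<open>For the case where the match of the remainder \<open>C\<close> is a full power
  \<open>W a 1 Z\<close>, which is then absorbed into the coefficient \<open>Suc b\<close>.\<close>

lemma near_absorb:
  assumes "near u c' (max 1 a)"
  shows "near u (max (u b) (max (u a) c')) (max (Suc b) a)"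
proof -
  have "u (max b a) \<le> max (u b) (max (u a) c') \<and> max (Suc b) a \<le> Suc (max b a)"
    by (auto simp: u_max)
  then show ?thesis using assms unfolding near_def by (fastforce simp: le_max_iff_disj)
qed

text \<open>\<open>A\<close> itself may differ from \<open>U x\<close>: where \<open>x\<close> has
  the coefficient \<open>Suc b\<close>, \<open>A\<close> may have \<open>Suc (u b)\<close>, possibly
  smaller than \<open>u (Suc b)\<close>. Only the fundamental sequences correspond.\<close>

definition limit_match :: "cnf \<Rightarrow> cnf \<Rightarrow> bool" where
  "limit_match A x \<longleftrightarrow> nf x \<and> x \<noteq> Z \<and> fin_cnf x = 0 \<and> (\<forall>n. U (fs_cnf x n) = fs_cnf A (u n))"

text \<open>The fundamental sequences are cofinal by \<open>less_fs_cnf\<close>. Together with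
  \<open>limit_match_le\<close> this makes \<open>x\<close> the least ordinal with
  \<open>A \<le> U x\<close>, for a limit \<open>A\<close> in normal form.\<close>

lemma limit_match_less:
  assumes "limit_match A x" "nf A" "A \<noteq> Z" "fin_cnf A = 0" "nf y" "U y < A"
  shows "y < x"
proof -
  define n where "n = Suc (mcc (U y))"
  have "mcc (U y) < u n" using le_u[of n] by (simp add: n_def)
  then have "U y < fs_cnf A (u n)" using assms by (intro less_fs_cnf) auto
  then have "y < fs_cnf x n" using assms by (metis limit_match_def U_less_iff)
  also have "\<dots> < x" using assms by (auto simp: limit_match_def intro: fs_cnf_less)
  finally show ?thesis .
qed

lemma limit_match_le:
  assumes "limit_match A x" "nf A" "A \<noteq> Z" "nf y" "A \<le> U y"
  shows "x \<le> y"
proof (rule ccontr)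
  assume "\<not> x \<le> y"
  then have "y < fs_cnf x (Suc (mcc y))"
    using assms by (intro less_fs_cnf) (auto simp: limit_match_def)
  then have "U y < U (fs_cnf x (Suc (mcc y)))" by simp
  also have "\<dots> = fs_cnf A (u (Suc (mcc y)))" using assms by (auto simp: limit_match_def)
  also have "\<dots> < A" using assms by (intro fs_cnf_less) auto
  finally show False using assms by simp
qed

text \<open>\<open>A\<close> arises from \<open>U \<xi>\<close> by truncating after some coefficient and incrementing, and \<open>x\<close> is the
  corresponding modification of \<open>\<xi>\<close>.\<close>

lemma ex_limit_match:
  assumes "nf A" "fin_cnf A = 0" "nf \<xi>" "U \<xi> < A" "fs_cnf A p \<le> U \<xi>" "0 < p"
  shows "\<exists>x. limit_match A x \<and> near u (mcc A) (mcc x)"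
  using assms(1-5)
proof (induction A arbitrary: \<xi>)
  case (W A B C)
  have A: "A \<noteq> Z" "nf A" "0 < B" "nf C" "C < W A 1 Z" using W.prems by auto
  show ?case
  proof (cases "C = Z")
    case False
    have "fin_cnf C = 0" using W.prems A by simp
    have *: "fs_cnf (W A B C) n = W A B (fs_cnf C n)" for n using False by simp
    obtain a b c where \<xi>: "\<xi> = W a b c" "U a = A" "u b = B" "fs_cnf C p \<le> U c" "U c < C"
      using W.prems(4,5) unfolding * by (cases \<xi>) auto
    then obtain \<gamma> where \<gamma>: "limit_match C \<gamma>" "near u (mcc C) (mcc \<gamma>)"
      using W.IH(2)[of c] W.prems A \<open>fin_cnf C = 0\<close> by auto
    have "C \<le> U (W a 1 Z)" using A \<xi> by simp
    then have "\<gamma> \<le> W a 1 Z" using limit_match_le[OF \<gamma>(1)] A False W.prems \<xi> by simp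
    then consider "\<gamma> < W a 1 Z" | "\<gamma> = W a 1 Z" by (auto simp: le_less)
    then show ?thesis
    proof cases
      case 1
      have "limit_match (W A B C) (W a b \<gamma>)"
        using \<gamma> 1 W.prems \<xi> * A unfolding limit_match_def by auto
      moreover have "near u (mcc (W A B C)) (mcc (W a b \<gamma>))"
        using \<gamma>(2) \<xi> unfolding mcc.simps by (auto simp: mcc_U intro!: near_max near_u)
      ultimately show ?thesis by blast
    next
      case 2
      \<comment> \<open>The remainder has grown to the full power with exponent \<open>a\<close>, so
        the match increments the coefficient \<open>b\<close> instead.\<close>
      have eq: "fs_cnf (W a (Suc b) Z) n = W a b (fs_cnf (W a 1 Z) n)" for n
        using W.prems \<xi> by simp
      have "limit_match (W A B C) (W a (Suc b) Z)"
        using \<gamma> 2 W.prems \<xi> * A unfolding limit_match_def eq by auto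
      moreover have "near u (mcc (W A B C)) (mcc (W a (Suc b) Z))"
        using near_absorb[of "mcc C" "mcc a" b] \<gamma>(2) \<xi> 2 by (auto simp: mcc_U)
      ultimately show ?thesis by blast
    qed
  next
    case True
    show ?thesis
    proof (cases "fin_cnf A > 0")
      case fin: True
      define E where "E = fs_cnf A 0"
      have E: "fs_cnf A n = E" for n unfolding E_def using fs_cnf_pred_const[OF A(2) fin] .
      have fs1: "fs_cnf (W A B C) n = (let d = (if n = 0 then Z else W E n Z) in if B = 1 then d else W A (B - 1) d)" for n
        using True A fin by (simp add: E)
      show ?thesis
      proof (cases "B = 1")
        case B: True
        \<comment> \<open>\<open>A\<close> is the successor of \<open>E\<close>, so the bounds on
          \<open>U \<xi>\<close> force its leading exponent to be \<open>E\<close>. The match is the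
          power whose exponent \<open>e'\<close> is the successor of \<open>e\<close>.\<close>
        obtain e n c where \<xi>: "\<xi> = W e n c" "E \<le> U e" "U e < A" "nf e"
          using W.prems(3-5) assms(6) unfolding fs1 by (cases \<xi>) (auto simp: le_less B True)
        then have Ue: "U e = E" using fs_cnf_pred_ge[OF A(2) _ fin, of "U e" 0] E by auto
        define e' where "e' = add_cnf e (W Z (Suc 0) Z)"
        have e': "nf e'" "fin_cnf e' = Suc (fin_cnf e)" "lim_cnf e' = lim_cnf e" "fs_cnf e' n = e" for n
          using add_1_cnf[OF \<xi>(4)] nf_add_cnf[OF \<xi>(4), of "W Z (Suc 0) Z"] by (auto simp: e'_def)
        then have "e' \<noteq> Z" by auto
        have "limit_match (W A B C) (W e' 1 Z)"
          unfolding limit_match_def fs1 using e' B Ue \<open>e' \<noteq> Z\<close> by auto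
        moreover have "mcc A = max (u (mcc (lim_cnf e))) (Suc (u (fin_cnf e)))"
          using mcc_lim_fin[OF A(2)] lim_fin_fs_cnf[OF A(2) fin, of 0] E Ue[symmetric]
          by (auto simp: lim_cnf_U mcc_U[symmetric])
        moreover have "mcc e' = max (mcc (lim_cnf e)) (Suc (fin_cnf e))"
          using mcc_lim_fin[OF e'(1)] e' by simp
        ultimately have "near u (mcc A) (mcc e')" by (auto intro: near_max near_u near_Suc)
        then have "near u (mcc (W A B C)) (mcc (W e' 1 Z))"
          using near_max[OF near_u[of 1]] B True by simp
        then show ?thesis using \<open>limit_match (W A B C) (W e' 1 Z)\<close> by blast
      next
        case B: False
        \<comment> \<open>For \<open>B > 1\<close> the leading term of \<open>U \<xi>\<close> has
          exponent \<open>A\<close> and coefficient \<open>B - 1\<close>, so the match increments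
          \<open>b\<close>.\<close>
        obtain a b c where \<xi>: "\<xi> = W a b c" "U a = A" "u b = B - 1" "W E p Z \<le> U c" "nf a" "0 < b" "nf c" "c < W a 1 Z"
          using W.prems(3-5) assms(6) B unfolding fs1 by (cases \<xi>) (auto simp: le_less True)
        then obtain e n c' where c: "c = W e n c'" "E \<le> U e" "e < a" "nf e"
          by (cases c) (auto simp: less_W1_nf)
        then have "U e \<le> E" using fs_cnf_pred_ge[OF A(2) _ fin, of "U e" 0] E \<xi>(2) by auto
        then have Ue: "U e = E" using c by simp
        have fina: "0 < fin_cnf a" using fin \<xi>(2)[symmetric] by simp
        have fsa: "fs_cnf a n = e" for n
        proof (rule antisym)
          have "U (fs_cnf a n) \<le> U e" using U_fs_cnf_le[OF \<xi>(5), of n] \<xi>(2) E Ue by simp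
          then show "fs_cnf a n \<le> e" by simp
          show "e \<le> fs_cnf a n" using fs_cnf_pred_ge[OF \<xi>(5) c(4) fina c(3)] .
        qed
        have "limit_match (W A B C) (W a (Suc b) Z)"
          unfolding limit_match_def fs1 using \<xi> fina fsa B Ue by (auto simp: Let_def)
        moreover have "near u (mcc (W A B C)) (mcc (W a (Suc b) Z))"
          using near_max[OF near_Suc[of b] near_u[of "mcc a"]] \<xi>(2,3) B True A(3)
          by (auto simp: mcc_U[symmetric])
        ultimately show ?thesis by blast
      qed
    next
      case fin: False
      have fs1: "fs_cnf (W A B C) n = (let d = W (fs_cnf A n) 1 Z in if B = 1 then d else W A (B - 1) d)" for n
        using True A fin by simp
      show ?thesis
      proof (cases "B = 1")
        case B: True
        obtain e n c where \<xi>: "\<xi> = W e n c" "fs_cnf A p \<le> U e" "U e < A" "nf e"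
          using W.prems(3-5) assms(6) unfolding fs1 by (cases \<xi>) (auto simp: le_less B True)
        then obtain \<delta> where \<delta>: "limit_match A \<delta>" "near u (mcc A) (mcc \<delta>)"
          using W.IH(1)[of e] A fin by auto
        have "limit_match (W A B C) (W \<delta> 1 Z)"
          using \<delta>(1) B unfolding limit_match_def fs1 by auto
        moreover have "near u (mcc (W A B C)) (mcc (W \<delta> 1 Z))"
          using near_max[OF near_u[of 1] \<delta>(2)] B True by simp
        ultimately show ?thesis by blast
      next
        case B: False
        obtain a b c where \<xi>: "\<xi> = W a b c" "U a = A" "u b = B - 1" "W (fs_cnf A p) 1 Z \<le> U c" "nf a" "0 < b" "nf c" "c < W a 1 Z"
          using W.prems(3-5) assms(6) B unfolding fs1 by (cases \<xi>) (auto simp: le_less True)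
        then obtain e n c' where c: "c = W e n c'" "fs_cnf A p \<le> U e" "e < a" "nf e"
          by (cases c) (auto simp: less_W1_nf)
        then obtain \<delta> where \<delta>: "limit_match A \<delta>" "near u (mcc A) (mcc \<delta>)"
          using W.IH(1)[of e] A fin \<xi>(2) by auto
        \<comment> \<open>Both \<open>a\<close> and \<open>\<delta>\<close> are the least ordinal
          that \<open>U\<close> maps to at least \<open>A\<close>, since
          \<open>U a = A\<close>.\<close>
        have "\<delta> \<le> a" using limit_match_le[OF \<delta>(1) A(2,1) \<xi>(5)] \<xi>(2) by simp
        moreover have "\<not> \<delta> < a"
          using limit_match_less[OF \<delta>(1) A(2,1), of \<delta>] fin \<delta>(1) \<xi>(2) by (auto simp: limit_match_def)
        ultimately have "\<delta> = a" by simp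
        then have "limit_match (W A B C) (W a (Suc b) Z)"
          using \<delta>(1) \<xi> B unfolding limit_match_def fs1 by (auto simp: Let_def)
        moreover have "near u (mcc (W A B C)) (mcc (W a (Suc b) Z))"
          using near_max[OF near_Suc[of b] near_u[of "mcc a"]] \<xi>(2,3) B True A(3)
          by (auto simp: mcc_U[symmetric])
        ultimately show ?thesis by blast
      qed
    qed
  qed
qed simp

end

section \<open>Monotonicity of \<open>A\<^sub>k\<close>\<close>

lemma less_fs: "is_limit \<alpha> \<Longrightarrow> \<zeta> < \<alpha> \<Longrightarrow> mc \<zeta> < n \<Longrightarrow> \<zeta> < fs \<alpha> n"
  unfolding is_limit_iff by transfer (auto intro: less_fs_cnf)

lemma mc_fs_between: "is_limit \<alpha> \<Longrightarrow> fs \<alpha> n < \<zeta> \<Longrightarrow> \<zeta> < \<alpha> \<Longrightarrow> mc (fs \<alpha> n) \<le> mc \<zeta>"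
  unfolding is_limit_iff by transfer (auto intro: mcc_fs_cnf_between)

lemma fs_mono: "n \<le> n' \<Longrightarrow> fs \<alpha> n \<le> fs \<alpha> n'"
  by transfer (rule fs_cnf_mono)

lemma mc_lim_fin: "mc \<xi> = max (mc (lim_part \<xi>)) (fin_part \<xi>)"
  by transfer (rule mcc_lim_fin)

lemma less_iff_fin_part: "lim_part \<xi> = lim_part \<zeta> \<Longrightarrow> \<xi> < \<zeta> \<longleftrightarrow> fin_part \<xi> < fin_part \<zeta>"
  by transfer (rule less_iff_fin_cnf)

lemma lim_part_mono: "\<xi> \<le> \<zeta> \<Longrightarrow> lim_part \<xi> \<le> lim_part \<zeta>"
  by transfer (rule lim_cnf_mono)

lemma lim_part_idem [simp]: "lim_part (lim_part \<xi>) = lim_part \<xi>"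
  by transfer (rule lim_cnf_idem)

lemma nat_e0_0 [simp]: "nat_e0 0 = 0"
  unfolding nat_e0_def by transfer simp

lemma lim_part_eq_between:
  "lim_part \<zeta> \<le> \<xi> \<Longrightarrow> \<xi> \<le> \<zeta> \<Longrightarrow> lim_part \<xi> = lim_part \<zeta>"
  using lim_part_mono[of "lim_part \<zeta>" \<xi>] lim_part_mono[of \<xi> \<zeta>] by simp

lemma lim_part_of_limit: "is_limit \<alpha> \<Longrightarrow> lim_part \<alpha> = \<alpha>"
  using lim_part_unique[of \<alpha> 0] by simp

lemma lim_fin_add_nat:
  "is_limit \<alpha> \<Longrightarrow> lim_part (\<alpha> + nat_e0 b) = \<alpha>" "is_limit \<alpha> \<Longrightarrow> fin_part (\<alpha> + nat_e0 b) = b"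
  using lim_part_unique by blast+

lemma le_zero_e0_iff [simp]: "(x :: e0) \<le> 0 \<longleftrightarrow> x = 0"
  by transfer simp

lemma not_less_zero_e0 [simp]: "\<not> (x :: e0) < 0"
  by transfer simp

section \<open>Coefficient maps on ordinals below epsilon zero\<close>

definition up :: "(nat \<Rightarrow> nat) \<Rightarrow> e0 \<Rightarrow> e0" where
  "up u \<xi> = Abs_e0 (map_coeffs u (Rep_e0 \<xi>))"

context coeff_map
begin

lemma Rep_up: "Rep_e0 (up u \<xi>) = U (Rep_e0 \<xi>)"
  using Rep_e0[of \<xi>] by (simp add: up_def Abs_e0_inverse)

lemma up_transfer [transfer_rule]: "rel_fun pcr_e0 pcr_e0 U (up u)"
  by (auto simp: rel_fun_def e0.pcr_cr_eq cr_e0_def Rep_up)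

lemma up_0 [simp]: "up u 0 = 0"
  by transfer simp

lemma up_eq_0_iff [simp]: "up u \<xi> = 0 \<longleftrightarrow> \<xi> = 0"
  by transfer simp

lemma up_less_iff [simp]: "up u \<xi> < up u \<zeta> \<longleftrightarrow> \<xi> < \<zeta>"
  by transfer simp

lemma up_le_iff [simp]: "up u \<xi> \<le> up u \<zeta> \<longleftrightarrow> \<xi> \<le> \<zeta>"
  by transfer simp

lemma mc_up: "mc (up u \<xi>) = u (mc \<xi>)"
  by transfer (rule mcc_U)

lemma lim_part_up: "lim_part (up u \<xi>) = up u (lim_part \<xi>)"
  by transfer (rule lim_cnf_U)

lemma fin_part_up: "fin_part (up u \<xi>) = u (fin_part \<xi>)"
  by transfer simp

lemma is_limit_up: "is_limit \<xi> \<Longrightarrow> is_limit (up u \<xi>)"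
  by (simp add: is_limit_iff fin_part_up)

lemma up_fs_le:
  "up u (fs \<xi> n) \<le> fs (up u \<xi>) (u n)" "mc (up u (fs \<xi> n)) \<le> mc (fs (up u \<xi>) (u n))"
  by (transfer, use U_fs_cnf_le in blast)+

lemma ex_matching_limit:
  assumes "is_limit \<alpha>'" "up u \<xi> < \<alpha>'" "fs \<alpha>' p \<le> up u \<xi>" "0 < p"
  obtains \<alpha> where "is_limit \<alpha>" "\<xi> < \<alpha>" "\<And>n. up u (fs \<alpha> n) = fs \<alpha>' (u n)" "near u (mc \<alpha>') (mc \<alpha>)"
proof -
  have A: "nf (Rep_e0 \<alpha>')" "fin_cnf (Rep_e0 \<alpha>') = 0" "Rep_e0 \<alpha>' \<noteq> Z" "nf (Rep_e0 \<xi>)"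
    "U (Rep_e0 \<xi>) < Rep_e0 \<alpha>'" "fs_cnf (Rep_e0 \<alpha>') p \<le> U (Rep_e0 \<xi>)"
    using assms Rep_e0[of \<alpha>'] Rep_e0[of \<xi>]
    by (auto simp: is_limit_iff fin_part.rep_eq less_e0.rep_eq less_eq_e0.rep_eq Rep_up fs.rep_eq
        Rep_e0_inject zero_e0.rep_eq simp flip: zero_e0.rep_eq)
  obtain x where x: "limit_match (Rep_e0 \<alpha>') x" "near u (mcc (Rep_e0 \<alpha>')) (mcc x)"
    using ex_limit_match[OF A(1,2,4,5,6) assms(4)] by blast
  have less: "Rep_e0 \<xi> < x" using limit_match_less[OF x(1) A(1,3,2,4,5)] .
  define \<alpha> where "\<alpha> = Abs_e0 x"
  have Rep: "Rep_e0 \<alpha> = x" using x(1) by (simp add: \<alpha>_def Abs_e0_inverse limit_match_def)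
  have mc: "mc \<xi> = mcc (Rep_e0 \<xi>)" for \<xi> by (simp add: mc_def mcc_eq_Max coeffs.rep_eq)
  show ?thesis
  proof (rule that)
    show "is_limit \<alpha>" unfolding is_limit_iff fin_part.rep_eq Rep
      using x(1) Rep by (auto simp: limit_match_def zero_e0.rep_eq)
    show "\<xi> < \<alpha>" using less by (simp add: less_e0.rep_eq Rep)
    show "up u (fs \<alpha> n) = fs \<alpha>' (u n)" for n
      using x(1) by (simp add: Rep_e0_inject[symmetric] Rep_up fs.rep_eq Rep limit_match_def)
    show "near u (mc \<alpha>') (mc \<alpha>)" using x(2) by (simp add: mc Rep)
  qed
qed

end

section \<open>Iteration along a fundamental sequence\<close>

definition fastA_fs :: "nat \<Rightarrow> e0 \<Rightarrow> nat \<Rightarrow> nat" where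
  "fastA_fs k \<alpha> x = fastA k (fs \<alpha> x)"

text \<open>The iteration at \<open>\<alpha> + (b + 1)\<close> starts from the value at
  \<open>\<alpha> + b\<close>, so each increment of the finite part contributes \<open>k\<close>
  further steps to one long iteration from \<open>mc \<alpha>\<close>.\<close>

lemma fastA_limit_add:
  assumes "is_limit \<alpha>"
  shows "fastA k (\<alpha> + nat_e0 b) = (fastA_fs k \<alpha> ^^ (k * Suc b)) (mc \<alpha>)"
proof (induction b)
  case 0
  have "\<alpha> \<noteq> 0" "mc (\<alpha> + nat_e0 0) = mc \<alpha>"
    using assms mc_lim_fin[of "\<alpha> + nat_e0 0"] by (auto simp: is_limit_iff lim_fin_add_nat)
  then show ?case using assms
    by (subst fastA_infinite)
      (auto simp: lim_fin_add_nat lim_part_of_limit is_limit_iff fastA_fs_def[abs_def])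
next
  case (Suc b)
  then show ?case using assms
    by (subst fastA_infinite)
      (auto simp: lim_fin_add_nat is_limit_iff fastA_fs_def[abs_def] funpow_add)
qed

lemma fastA_limit: "is_limit \<alpha> \<Longrightarrow> fastA k \<alpha> = (fastA_fs k \<alpha> ^^ k) (mc \<alpha>)"
  using fastA_limit_add[of \<alpha> k 0] lim_fin_part[of \<alpha>]
  by (simp add: lim_part_of_limit is_limit_iff)

lemma fastA_limit_add_Suc:
  assumes "is_limit \<alpha>"
  shows "fastA k (\<alpha> + nat_e0 (Suc b)) = (fastA_fs k \<alpha> ^^ k) (fastA k (\<alpha> + nat_e0 b))"
  using assms by (simp add: fastA_limit_add funpow_add)

lemma less_fastA_fs: "1 \<le> k \<Longrightarrow> is_limit \<alpha> \<Longrightarrow> x < fastA_fs k \<alpha> x"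
  unfolding fastA_fs_def using mc_less_fastA[of k "fs \<alpha> x"] le_mc_fs[of \<alpha> x] by simp

lemma add_le_funpow_fastA_fs: "1 \<le> k \<Longrightarrow> is_limit \<alpha> \<Longrightarrow> x + i \<le> (fastA_fs k \<alpha> ^^ i) x"
  by (rule iterate_ge) (rule less_fastA_fs)

lemma funpow_fastA_fs_le: "1 \<le> k \<Longrightarrow> is_limit \<alpha> \<Longrightarrow> i \<le> j \<Longrightarrow> (fastA_fs k \<alpha> ^^ i) x \<le> (fastA_fs k \<alpha> ^^ j) x"
  using add_le_funpow_fastA_fs[of k \<alpha> "(fastA_fs k \<alpha> ^^ i) x" "j - i"]
  by (auto simp: funpow_add[symmetric, THEN fun_cong, unfolded comp_def])

text \<open>Let \<alpha> be the limit part of \<xi>. If \<eta> lies below \<alpha> and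
  \<open>mc \<eta> < x\<close>, then \<eta> lies below \<open>fs \<alpha> x\<close>, which has
  maximal coefficient at least \<open>x\<close>; so induction applies to
  \<open>fs \<alpha> x\<close>.\<close>

lemma fastA_strict_mono:
  assumes "2 \<le> k" "\<zeta> < \<xi>" "mc \<zeta> \<le> mc \<xi>"
  shows "fastA k \<zeta> < fastA k \<xi>"
  using assms(2,3)
proof (induction \<xi> arbitrary: \<zeta> rule: less_induct)
  case (less \<xi>)
  define \<alpha> where "\<alpha> = lim_part \<xi>"
  have k1: "1 \<le> k" using assms(1) by simp
  show ?case
  proof (cases "\<alpha> = 0")
    case True
    then have "lim_part \<zeta> = 0" using lim_part_mono[of \<zeta> \<xi>] less.prems by (simp add: \<alpha>_def)
    then show ?thesis using less.prems less_iff_fin_part[of \<zeta> \<xi>] True by (simp add: \<alpha>_def fastA_finite)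
  next
    case False
    then have lim: "is_limit \<alpha>" using lim_part_limit[of \<xi>] by (simp add: \<alpha>_def)
    have eq: "\<xi> = \<alpha> + nat_e0 (fin_part \<xi>)" using lim_fin_part[of \<xi>] by (simp add: \<alpha>_def)
    have "\<alpha> \<le> \<xi>" using lim_part_le by (simp add: \<alpha>_def)
    have key: "fastA k \<eta> < fastA_fs k \<alpha> x" if "\<eta> < \<alpha>" "mc \<eta> < x" for \<eta> x
      unfolding fastA_fs_def
    proof (rule less.IH)
      show "fs \<alpha> x < \<xi>" using fs_less[OF False, of x] \<open>\<alpha> \<le> \<xi>\<close> by simp
      show "\<eta> < fs \<alpha> x" using less_fs[OF lim] that by simp
      show "mc \<eta> \<le> mc (fs \<alpha> x)" using le_mc_fs[OF lim, of x] that by simp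
    qed
    \<comment> \<open>Here \<open>2 \<le> k\<close> enters: the first \<open>Suc j\<close>
      iterations lift the argument above \<open>mc \<eta>\<close>, and the last one uses
      \<open>key\<close>.\<close>
    obtain j where k: "k = Suc (Suc j)" using assms(1) by (metis add_2_eq_Suc le_Suc_ex)
    have key': "fastA k \<eta> < (fastA_fs k \<alpha> ^^ k) x" if "\<eta> < \<alpha>" "mc \<eta> \<le> x" for \<eta> x
    proof -
      have "mc \<eta> < (fastA_fs k \<alpha> ^^ Suc j) x"
        using add_le_funpow_fastA_fs[OF k1 lim, of x "Suc j"] that by simp
      from key[OF that(1) this] show ?thesis by (simp add: k)
    qed
    show ?thesis
    proof (cases "fin_part \<xi>")
      case 0
      then have "\<xi> = \<alpha>" using eq lim by (metis lim_fin_part lim_part_of_limit is_limit_iff)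
      then show ?thesis using key'[of \<zeta> "mc \<alpha>"] less.prems fastA_limit[OF lim, of k] by simp
    next
      case (Suc c)
      define \<eta> where "\<eta> = \<alpha> + nat_e0 c"
      have lf: "lim_part \<eta> = \<alpha>" "fin_part \<eta> = c" using lim by (simp_all add: \<eta>_def lim_fin_add_nat)
      have A: "fastA k \<xi> = (fastA_fs k \<alpha> ^^ k) (fastA k \<eta>)"
        using fastA_limit_add_Suc[OF lim, of k c] eq Suc by (simp add: \<eta>_def)
      have "mc \<xi> \<le> Suc (mc \<eta>)"
        using mc_lim_fin[of \<xi>] mc_lim_fin[of \<eta>] lf Suc by (simp add: \<alpha>_def)
      have "\<eta> < \<xi>" using less_iff_fin_part[of \<eta> \<xi>] lf Suc by (simp add: \<alpha>_def)
      have A_less: "fastA k \<eta> < fastA k \<xi>"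
        unfolding A using add_le_funpow_fastA_fs[OF k1 lim, of "fastA k \<eta>" k] k1 by simp
      show ?thesis
      proof (cases "\<zeta> < \<alpha>")
        case True
        \<comment> \<open>\<open>mc \<xi>\<close> may exceed \<open>mc \<eta>\<close> by one, but so
          does \<open>fastA k \<eta>\<close> at least.\<close>
        have "mc \<zeta> \<le> fastA k \<eta>"
          using less.prems \<open>mc \<xi> \<le> Suc (mc \<eta>)\<close> mc_less_fastA[OF k1, of \<eta>] by simp
        then show ?thesis using key'[OF True] A by simp
      next
        case False
        then have lz: "lim_part \<zeta> = \<alpha>"
          using lim_part_mono[of \<alpha> \<zeta>] lim_part_mono[of \<zeta> \<xi>] less.prems
          by (intro antisym) (simp_all add: \<alpha>_def)
        then have fz: "fin_part \<zeta> \<le> c" using less_iff_fin_part[of \<zeta> \<xi>] less.prems Suc by (simp add: \<alpha>_def)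
        show ?thesis
        proof (cases "fin_part \<zeta> = c")
          case True
          then have "\<zeta> = \<eta>" using lim_fin_part[of \<zeta>] lz by (simp add: \<eta>_def)
          then show ?thesis using A_less by simp
        next
          case False
          then have "\<zeta> < \<eta>" using less_iff_fin_part[of \<zeta> \<eta>] lz lf fz by simp
          moreover have "mc \<zeta> \<le> mc \<eta>" using mc_lim_fin[of \<zeta>] mc_lim_fin[of \<eta>] lz lf fz by simp
          ultimately show ?thesis using less.IH[of \<eta> \<zeta>] \<open>\<eta> < \<xi>\<close> A_less by simp
        qed
      qed
    qed
  qed
qed

lemma fastA_mono: "2 \<le> k \<Longrightarrow> \<zeta> \<le> \<xi> \<Longrightarrow> mc \<zeta> \<le> mc \<xi> \<Longrightarrow> fastA k \<zeta> \<le> fastA k \<xi>"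
  using fastA_strict_mono by (auto simp: le_less)

lemma mc_fs_mono: "is_limit \<alpha> \<Longrightarrow> x \<le> y \<Longrightarrow> mc (fs \<alpha> x) \<le> mc (fs \<alpha> y)"
  using fs_mono[of x y \<alpha>] mc_fs_between[of \<alpha> x "fs \<alpha> y"] fs_less[of \<alpha> y]
  by (auto simp: le_less is_limit_iff)

lemma fastA_fs_mono: "2 \<le> k \<Longrightarrow> is_limit \<alpha> \<Longrightarrow> x \<le> y \<Longrightarrow> fastA_fs k \<alpha> x \<le> fastA_fs k \<alpha> y"
  unfolding fastA_fs_def by (intro fastA_mono fs_mono mc_fs_mono)

lemma funpow_fastA_fs_mono:
  assumes "2 \<le> k" "is_limit \<alpha>" "x \<le> y"
  shows "(fastA_fs k \<alpha> ^^ i) x \<le> (fastA_fs k \<alpha> ^^ i) y"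
  by (induction i) (use assms in \<open>auto intro: fastA_fs_mono\<close>)

section \<open>Preservation of normal forms\<close>

text \<open>\<open>chain k m \<xi>\<close> means that \<open>\<xi>\<close> is one of the \<open>\<xi>\<^sub>i\<close> leading to the \<open>k\<close>-normal form of \<open>m\<close>. Unlike
  \<open>knf_next\<close>, the relation \<open>nxt\<close> does not restart at \<open>0\<close> once the value \<open>m\<close> has been reached.\<close>

definition nxt :: "nat \<Rightarrow> nat \<Rightarrow> e0 \<Rightarrow> e0 \<Rightarrow> bool" where
  "nxt k m \<xi> \<xi>' \<longleftrightarrow> fastA k \<xi>' \<le> m \<and> fastA k \<xi> \<le> mc \<xi>' \<and>
     (\<forall>\<zeta>. fastA k \<zeta> \<le> m \<longrightarrow> fastA k \<xi> \<le> mc \<zeta> \<longrightarrow> \<zeta> \<le> \<xi>')"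

inductive chain :: "nat \<Rightarrow> nat \<Rightarrow> e0 \<Rightarrow> bool" for k m where
  chain_0: "0 < m \<Longrightarrow> chain k m 0"
| chain_step: "chain k m \<xi> \<Longrightarrow> nxt k m \<xi> \<xi>' \<Longrightarrow> chain k m \<xi>'"

lemma fastA_nat_e0: "fastA k (nat_e0 n) = Suc n"
  using lim_part_unique[of 0 n] by (simp add: fastA_finite)

lemma mc_nat_e0: "mc (nat_e0 n) = n"
proof -
  have "lim_part (nat_e0 n) = 0" "fin_part (nat_e0 n) = n" using lim_part_unique[of 0 n] by simp_all
  moreover have "mc 0 = 0" by transfer simp
  ultimately show ?thesis using mc_lim_fin[of "nat_e0 n"] by simp
qed

lemma ex_nxt:
  assumes "2 \<le> k" "fastA k \<xi> < m"
  shows "\<exists>\<xi>'. nxt k m \<xi> \<xi>'"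
proof -
  define S where "S = {\<zeta>. fastA k \<zeta> \<le> m \<and> fastA k \<xi> \<le> mc \<zeta>}"
  have "finite S"
    by (rule finite_subset[OF _ finite_fastA_le[OF assms(1), of m]]) (auto simp: S_def)
  moreover have "nat_e0 (fastA k \<xi>) \<in> S"
    using assms(2) by (simp add: S_def fastA_nat_e0 mc_nat_e0)
  ultimately have "Max S \<in> S" "\<forall>\<zeta>\<in>S. \<zeta> \<le> Max S" using Max_in[of S] Max_ge[of S] by blast+
  then have "nxt k m \<xi> (Max S)" by (auto simp: nxt_def S_def)
  then show ?thesis by blast
qed

lemma nxt_fastA_less: "1 \<le> k \<Longrightarrow> nxt k m \<xi> \<xi>' \<Longrightarrow> fastA k \<xi> < fastA k \<xi>'"
  using mc_less_fastA[of k \<xi>'] by (simp add: nxt_def)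

lemma knf_next_eq: "nxt k m \<xi> \<xi>' \<Longrightarrow> knf_next k m \<xi> = \<xi>'"
  unfolding knf_next_def nxt_def Let_def by (subst if_P) (auto intro!: Greatest_equality)

lemma chain_le: "chain k m \<xi> \<Longrightarrow> fastA k \<xi> \<le> m"
  by (induction rule: chain.induct) (auto simp: fastA_0 nxt_def)

lemma knf_of_chain: "chain k (fastA k \<xi>) \<xi> \<Longrightarrow> knf k (fastA k \<xi>) \<xi>"
proof -
  have "0 < m \<and> (\<exists>n. (knf_next k m ^^ n) 0 = \<xi>)" if "chain k m \<xi>" for m
    using that
  proof (induction rule: chain.induct)
    case chain_0
    then show ?case by (auto intro: exI[of _ 0])
  next
    case (chain_step \<xi> \<xi>')
    then obtain n where "(knf_next k m ^^ n) 0 = \<xi>" by blast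
    then show ?case using chain_step knf_next_eq by (auto intro!: exI[of _ "Suc n"])
  qed
  moreover assume "chain k (fastA k \<xi>) \<xi>"
  ultimately obtain n where "0 < fastA k \<xi>" "(knf_next k (fastA k \<xi>) ^^ n) 0 = \<xi>" by blast
  then show ?thesis
    unfolding knf_def by (intro conjI exI[of _ n] exI[of _ "\<lambda>i. (knf_next k (fastA k \<xi>) ^^ i) 0"]) auto
qed

text \<open>Values strictly increase along the chain and never exceed \<open>m\<close>, so
  \<open>m\<close> is reached; every later member has a coefficient no smaller than the value of
  \<xi>.\<close>

lemma chain_complete:
  assumes "2 \<le> k" "chain k m \<xi>" "fastA k \<xi> < m"
  shows "\<exists>\<zeta>. knf k m \<zeta> \<and> chain k m \<zeta> \<and> fastA k \<xi> \<le> mc \<zeta>"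
  using assms(2,3)
proof (induction "m - fastA k \<xi>" arbitrary: \<xi> rule: less_induct)
  case less
  obtain \<xi>' where \<xi>': "nxt k m \<xi> \<xi>'" using ex_nxt assms(1) less by blast
  then have chain: "chain k m \<xi>'" using less chain_step by blast
  have lt: "fastA k \<xi> < fastA k \<xi>'" using nxt_fastA_less[OF _ \<xi>'] assms(1) by simp
  show ?case
  proof (cases "fastA k \<xi>' = m")
    case True
    then show ?thesis using chain \<xi>' knf_of_chain by (auto simp: nxt_def)
  next
    case False
    then have "fastA k \<xi>' < m" using chain_le[OF chain] by simp
    then have "m - fastA k \<xi>' < m - fastA k \<xi>" using lt by simp
    then obtain \<zeta> where "knf k m \<zeta>" "chain k m \<zeta>" "fastA k \<xi>' \<le> mc \<zeta>"
      using less.hyps[OF _ chain] \<open>fastA k \<xi>' < m\<close> by blast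
    then show ?thesis using lt by (intro exI[of _ \<zeta>]) simp
  qed
qed

lemma knf_iff_chain:
  assumes "2 \<le> k"
  shows "knf k m \<xi> \<longleftrightarrow> chain k m \<xi> \<and> fastA k \<xi> = m"
proof
  assume knf: "knf k m \<xi>"
  then have m: "0 < m" "fastA k \<xi> = m" by (auto simp: knf_def)
  have "\<exists>\<zeta>. knf k m \<zeta> \<and> chain k m \<zeta>"
  proof (cases "m = 1")
    case True
    then show ?thesis using knf_of_chain[of k 0] chain_0[of m k] m by (auto simp: fastA_0)
  next
    case False
    then show ?thesis using chain_complete[OF assms chain_0[OF m(1)]] m by (auto simp: fastA_0)
  qed
  then show "chain k m \<xi> \<and> fastA k \<xi> = m" using knf_ex1[OF assms m(1)] knf m by blast
qed (use knf_of_chain in blast)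

lemma knf_coeff_ge:
  assumes "2 \<le> k" "chain k m \<xi>" "fastA k \<xi> < m" "knf k m \<zeta>"
  shows "fastA k \<xi> \<le> mc \<zeta>"
  using chain_complete[OF assms(1-3)] knf_ex1[OF assms(1)] assms(4) by (metis knf_def)

text \<open>A maximum among the competitors of value at most \<open>m\<close> stays the maximum for
  a smaller bound \<open>n\<close>, provided its own value is at most \<open>n\<close>.\<close>

lemma chain_restrict:
  assumes "1 \<le> k"
  shows "chain k m \<xi> \<Longrightarrow> fastA k \<xi> \<le> n \<Longrightarrow> n \<le> m \<Longrightarrow> chain k n \<xi>"
proof (induction rule: chain.induct)
  case chain_0
  then show ?case by (auto simp: fastA_0 intro: chain.chain_0)
next
  case (chain_step \<xi> \<xi>')
  have "chain k n \<xi>" using chain_step nxt_fastA_less[OF assms chain_step(2)] by simp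
  moreover have "nxt k n \<xi> \<xi>'" using chain_step by (auto simp: nxt_def)
  ultimately show ?case by (rule chain.chain_step)
qed

text \<open>A competitor above \<open>fs \<alpha> x\<close> lies below \<alpha> by
  \<open>above\<close>, so its maximal coefficient is at least that of \<open>fs \<alpha> x\<close>,
  and strict monotonicity makes its value too large.\<close>

lemma knf_fs:
  assumes "2 \<le> k" "chain k m \<xi>" "is_limit \<alpha>" "fastA k \<xi> \<le> x" "fastA k (fs \<alpha> x) \<le> m"
    and above: "\<And>\<zeta>. \<alpha> \<le> \<zeta> \<Longrightarrow> fastA k \<xi> \<le> mc \<zeta> \<Longrightarrow> m < fastA k \<zeta>"
  shows "knf k (fastA k (fs \<alpha> x)) (fs \<alpha> x)"
proof (rule knf_of_chain)
  let ?n = "fastA k (fs \<alpha> x)"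
  have mc: "x \<le> mc (fs \<alpha> x)" using le_mc_fs[OF assms(3)] .
  have "mc (fs \<alpha> x) < ?n" using mc_less_fastA[of k "fs \<alpha> x"] assms(1) by simp
  then have "chain k ?n \<xi>" using chain_restrict[OF _ assms(2) _ assms(5)] assms(1,4) mc by linarith
  moreover have "\<zeta> \<le> fs \<alpha> x" if "fastA k \<zeta> \<le> ?n" "fastA k \<xi> \<le> mc \<zeta>" for \<zeta>
  proof (rule ccontr)
    assume "\<not> \<zeta> \<le> fs \<alpha> x"
    moreover have "\<zeta> < \<alpha>" using above[of \<zeta>] that assms(5) by fastforce
    ultimately have "mc (fs \<alpha> x) \<le> mc \<zeta>" "fs \<alpha> x < \<zeta>" using mc_fs_between[OF assms(3), of x \<zeta>] by auto
    then show False using fastA_strict_mono[of k "fs \<alpha> x" \<zeta>] assms(1) that by simp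
  qed
  ultimately show "chain k ?n (fs \<alpha> x)" using mc assms(4) by (auto simp: nxt_def intro: chain_step)
qed

text \<open>\<open>u\<close> is tied to base change only up to \<open>m\<close>, so the locale can
  be used inside the induction that proves base change strictly increasing.\<close>

locale base_step = coeff_map +
  fixes k l m :: nat
  assumes k2: "2 \<le> k" and kl: "k < l"
    and u_knf: "n \<le> m \<Longrightarrow> knf k n \<xi> \<Longrightarrow> u n = fastA l (up u \<xi>)"
begin

lemma k1: "1 \<le> k" and l1: "1 \<le> l" and l2: "2 \<le> l"
  using k2 kl by simp_all

text \<open>As long as the iterates of \<open>fastA_fs k \<alpha>\<close> stay below \<open>m\<close> they are given by \<open>k\<close>-normal forms, so
  that \<open>u_knf\<close> evaluates \<open>u\<close> on them; \<open>IH\<close> takes over at the first iterate exceeding \<open>m\<close>.\<close>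

lemma iterate_less:
  assumes lim: "is_limit \<alpha>" "is_limit \<alpha>'"
    and match: "\<And>n. up u (fs \<alpha> n) \<le> fs \<alpha>' (u n)" "\<And>n. mc (up u (fs \<alpha> n)) \<le> mc (fs \<alpha>' (u n))"
    and chain: "chain k m \<xi>"
    and above: "\<And>\<zeta>. \<alpha> \<le> \<zeta> \<Longrightarrow> fastA k \<xi> \<le> mc \<zeta> \<Longrightarrow> m < fastA k \<zeta>"
    and IH: "\<And>\<zeta> \<xi>'. \<zeta> < \<alpha>' \<Longrightarrow> nxt k m \<xi> \<xi>' \<Longrightarrow> up u \<xi>' < \<zeta> \<Longrightarrow> u (fastA k \<xi>) \<le> mc \<zeta> \<Longrightarrow> u m < fastA l \<zeta>"
  shows "fastA k \<xi> \<le> z \<Longrightarrow> u z \<le> w \<Longrightarrow> m < (fastA_fs k \<alpha> ^^ J) z \<Longrightarrow> u m < (fastA_fs l \<alpha>' ^^ J) w"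
proof (induction J arbitrary: z w)
  case 0
  then have "u m < u z" by simp
  then show ?case using 0 by (simp del: u_less_iff)
next
  case (Suc J)
  have z: "z < fastA_fs k \<alpha> z" using less_fastA_fs[OF k1 lim(1)] .
  show ?case
  proof (cases "fastA_fs k \<alpha> z \<le> m")
    case True
    then have "knf k (fastA_fs k \<alpha> z) (fs \<alpha> z)"
      using knf_fs[OF k2 chain lim(1) Suc.prems(1) _ above] by (simp add: fastA_fs_def)
    then have "u (fastA_fs k \<alpha> z) = fastA l (up u (fs \<alpha> z))" using u_knf True by blast
    also have "\<dots> \<le> fastA_fs l \<alpha>' (u z)" unfolding fastA_fs_def by (intro fastA_mono l2 match)
    also have "\<dots> \<le> fastA_fs l \<alpha>' w" by (intro fastA_fs_mono l2 lim Suc.prems)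
    finally show ?thesis
      using Suc.IH[of "fastA_fs k \<alpha> z" "fastA_fs l \<alpha>' w"] Suc.prems z by (simp add: funpow_swap1)
  next
    case False
    have "u m < fastA_fs l \<alpha>' w"
    proof (cases "fastA k \<xi> < m")
      case True
      \<comment> \<open>The value of \<open>fs \<alpha> z\<close> exceeds \<open>m\<close>, which
        places it above the next chain member \<xi>'. Hence \<open>fs \<alpha>' w\<close> lies above
        \<open>up u \<xi>'\<close> and \<open>IH\<close> applies to it.\<close>
      then obtain \<xi>' where \<xi>': "nxt k m \<xi> \<xi>'" using ex_nxt k2 by blast
      have "\<xi>' < fs \<alpha> z"
      proof (rule ccontr)
        assume "\<not> \<xi>' < fs \<alpha> z"
        moreover have "\<xi>' < \<alpha>" using above[of \<xi>'] \<xi>' by (force simp: nxt_def)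
        ultimately have "fs \<alpha> z = \<xi>' \<or> fs \<alpha> z < \<xi>'" "fs \<alpha> z < \<xi>' \<Longrightarrow> mc (fs \<alpha> z) \<le> mc \<xi>'"
          using mc_fs_between[OF lim(1), of z \<xi>'] by auto
        then have "fs \<alpha> z \<le> \<xi>'" "mc (fs \<alpha> z) \<le> mc \<xi>'" by auto
        then show False using fastA_mono[OF k2, of "fs \<alpha> z" \<xi>'] \<xi>' False by (simp add: nxt_def fastA_fs_def)
      qed
      then have "up u \<xi>' < up u (fs \<alpha> z)" by simp
      also have "\<dots> \<le> fs \<alpha>' (u z)" by (rule match)
      also have "\<dots> \<le> fs \<alpha>' w" by (intro fs_mono Suc.prems)
      finally have "up u \<xi>' < fs \<alpha>' w" .
      moreover have "u (fastA k \<xi>) \<le> u z" using Suc.prems by simp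
      then have "u (fastA k \<xi>) \<le> mc (fs \<alpha>' w)"
        using Suc.prems(2) le_mc_fs[OF lim(2), of w] by (meson order_trans)
      moreover have "fs \<alpha>' w < \<alpha>'" using fs_less lim by (simp add: is_limit_iff)
      ultimately show ?thesis unfolding fastA_fs_def using IH \<xi>' by blast
    next
      case False
      then have "u m \<le> u z" using Suc.prems by simp
      then show ?thesis using Suc.prems(2) less_fastA_fs[OF l1 lim(2), of w] by linarith
    qed
    also have "\<dots> \<le> (fastA_fs l \<alpha>' ^^ Suc J) w"
      using funpow_fastA_fs_le[OF l1 lim(2), of 1 "Suc J" w] by simp
    finally show ?thesis .
  qed
qed

lemma up_nxt_maximal:
  assumes "chain k m \<xi>" "nxt k m \<xi> \<xi>'" "up u \<xi>' < \<zeta>" "u (fastA k \<xi>) \<le> mc \<zeta>"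
  shows "u m < fastA l \<zeta>"
  using assms
proof (induction \<zeta> arbitrary: \<xi> \<xi>' rule: less_induct)
  case (less \<zeta>)
  note chain = less.prems(1) and nxt = less.prems(2)
  define a where "a = fastA k \<xi>"
  have nxt': "fastA k \<xi>' \<le> m" "a \<le> mc \<xi>'" "\<And>\<zeta>. \<xi>' < \<zeta> \<Longrightarrow> a \<le> mc \<zeta> \<Longrightarrow> m < fastA k \<zeta>"
    using nxt by (auto simp: nxt_def a_def not_le[symmetric])
  have a_less: "a < fastA k \<xi>'" unfolding a_def using nxt_fastA_less[OF k1 nxt] .
  have chain': "chain k m \<xi>'" using chain nxt chain_step by blast
  have u_fastA: "u (fastA k \<xi>') = fastA l (up u \<xi>')"
    using u_knf[OF nxt'(1)] knf_of_chain chain_restrict[OF k1 chain'] nxt'(1) by simp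
  define \<alpha>' where "\<alpha>' = lim_part \<zeta>"
  define b' where "b' = fin_part \<zeta>"
  have \<zeta>: "\<zeta> = \<alpha>' + nat_e0 b'" unfolding \<alpha>'_def b'_def by (rule lim_fin_part)
  have mc\<zeta>: "mc \<zeta> = max (mc \<alpha>') b'" unfolding \<alpha>'_def b'_def by (rule mc_lim_fin)
  have "\<alpha>' \<le> \<zeta>" unfolding \<alpha>'_def by (rule lim_part_le)
  show ?case
  proof (cases "\<alpha>' \<le> up u \<xi>'")
    case True
    \<comment> \<open>Here \<zeta> and \<open>up u \<xi>'\<close> share their limit part. By
      maximality of \<xi>' its successor \<eta> has value above \<open>m\<close>. From \<xi>' to
      \<eta> there are \<open>k\<close> iterations, whereas from \<open>up u \<xi>'\<close> to
      \<zeta> there are at least \<open>l\<close>.\<close>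
    define \<alpha> where "\<alpha> = lim_part \<xi>'"
    define c where "c = fin_part \<xi>'"
    have "lim_part (up u \<xi>') = lim_part \<zeta>"
      using lim_part_eq_between[of \<zeta> "up u \<xi>'"] True less.prems by (simp add: \<alpha>'_def)
    then have \<alpha>': "\<alpha>' = up u \<alpha>" and b': "u c < b'"
      using less_iff_fin_part[of "up u \<xi>'" \<zeta>] less.prems(3)
      by (simp_all add: \<alpha>'_def \<alpha>_def b'_def c_def lim_part_up fin_part_up)
    have \<xi>': "\<xi>' = \<alpha> + nat_e0 c" unfolding \<alpha>_def c_def by (rule lim_fin_part)
    define \<eta> where "\<eta> = \<alpha> + nat_e0 (Suc c)"
    have lf: "lim_part \<eta> = \<alpha>" "fin_part \<eta> = Suc c"
      using lim_part_unique[of \<alpha> "Suc c"] lim_part_limit[of \<xi>'] by (simp_all add: \<eta>_def \<alpha>_def)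
    have "\<xi>' < \<eta>" using less_iff_fin_part[of \<xi>' \<eta>] lf by (simp add: \<alpha>_def c_def)
    moreover have "mc \<xi>' \<le> mc \<eta>" using mc_lim_fin[of \<xi>'] mc_lim_fin[of \<eta>] lf by (simp add: \<alpha>_def c_def)
    ultimately have m_less: "m < fastA k \<eta>" using nxt'(2,3) by simp
    show ?thesis
    proof (cases "\<alpha> = 0")
      case True
      then have "\<xi>' = nat_e0 c" "\<eta> = nat_e0 (Suc c)" "\<zeta> = nat_e0 b'" using \<xi>' \<eta>_def \<zeta> \<alpha>' by simp_all
      then have "m = fastA k \<xi>'" "fastA l (up u \<xi>') = Suc (u c)" "fastA l \<zeta> = Suc b'"
        using m_less nxt'(1) True
        by (simp_all add: fastA_nat_e0 fastA_finite lim_part_up fin_part_up lim_part_unique[of 0, simplified])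
      then show ?thesis using u_fastA b' by simp
    next
      case False
      then have lim: "is_limit \<alpha>" "is_limit \<alpha>'" using lim_part_limit[of \<xi>'] by (auto simp: \<alpha>_def \<alpha>' is_limit_up)
      have above: "m < fastA k \<zeta>'" if "\<alpha> \<le> \<zeta>'" "fastA k \<xi>' \<le> mc \<zeta>'" for \<zeta>'
      proof (cases "\<zeta>' \<le> \<xi>'")
        case True
        then have "lim_part \<zeta>' = lim_part \<xi>'" using lim_part_eq_between[of \<xi>' \<zeta>'] that by (simp add: \<alpha>_def)
        then have "mc \<zeta>' \<le> mc \<xi>'"
          using mc_lim_fin[of \<xi>'] mc_lim_fin[of \<zeta>'] less_iff_fin_part[of \<xi>' \<zeta>'] True by auto
        then show ?thesis using that mc_less_fastA[OF k1, of \<xi>'] by simp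
      next
        case False
        then show ?thesis using nxt'(3) that a_less by simp
      qed
      have "u m < (fastA_fs l \<alpha>' ^^ k) (fastA l (up u \<xi>'))"
      proof (rule iterate_less[OF lim _ _ chain' above])
        show "up u (fs \<alpha> n) \<le> fs \<alpha>' (u n)" "mc (up u (fs \<alpha> n)) \<le> mc (fs \<alpha>' (u n))" for n
          unfolding \<alpha>' by (rule up_fs_le)+
        show "m < (fastA_fs k \<alpha> ^^ k) (fastA k \<xi>')"
          using m_less fastA_limit_add_Suc[OF lim(1), of k c] by (simp add: \<eta>_def \<xi>')
        show "u m < fastA l \<zeta>''" if "\<zeta>'' < \<alpha>'" "nxt k m \<xi>' \<xi>''" "up u \<xi>'' < \<zeta>''" "u (fastA k \<xi>') \<le> mc \<zeta>''" for \<zeta>'' \<xi>''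
          using less.IH[OF _ chain' that(2-4)] that(1) \<open>\<alpha>' \<le> \<zeta>\<close> by simp
      qed (use u_fastA in simp_all)
      also have "\<dots> \<le> (fastA_fs l \<alpha>' ^^ l) (fastA l (up u \<xi>'))"
        by (rule funpow_fastA_fs_le[OF l1 lim(2)]) (use kl in simp)
      also have "up u \<xi>' = \<alpha>' + nat_e0 (u c)"
        using lim_fin_part[of "up u \<xi>'"] by (simp add: lim_part_up fin_part_up \<alpha>' \<alpha>_def c_def)
      then have "(fastA_fs l \<alpha>' ^^ l) (fastA l (up u \<xi>')) = (fastA_fs l \<alpha>' ^^ (l * Suc (Suc (u c)))) (mc \<alpha>')"
        using fastA_limit_add_Suc[OF lim(2), of l "u c"] fastA_limit_add[OF lim(2), of l "Suc (u c)"] by simp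
      also have "\<dots> \<le> (fastA_fs l \<alpha>' ^^ (l * Suc b')) (mc \<alpha>')"
        by (rule funpow_fastA_fs_le[OF l1 lim(2)]) (use b' in \<open>intro mult_le_mono2, simp\<close>)
      also have "\<dots> = fastA l \<zeta>" using fastA_limit_add[OF lim(2)] \<zeta> by simp
      finally show ?thesis .
    qed
  next
    case False
    then have "up u \<xi>' < \<alpha>'" by simp
    then have lim': "is_limit \<alpha>'" using lim_part_limit[of \<zeta>] by (auto simp flip: \<alpha>'_def)
    \<comment> \<open>\<open>p\<close> is the iterate before the last, so \<zeta> and
      \<open>fs \<alpha>' p\<close> have the same value. If \<open>fs \<alpha>' p\<close> still lies
      above \<open>up u \<xi>'\<close>, it is a smaller competitor.\<close>
    define p where "p = (fastA_fs l \<alpha>' ^^ (l * Suc b' - 1)) (mc \<alpha>')"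
    have A\<zeta>: "fastA l \<zeta> = (fastA_fs l \<alpha>' ^^ (l * Suc b')) (mc \<alpha>')"
      using fastA_limit_add[OF lim'] \<zeta> by simp
    also have "l * Suc b' = Suc (l * Suc b' - 1)" using l1 by simp
    finally have "fastA l \<zeta> = fastA_fs l \<alpha>' p" by (simp add: p_def)
    then have A\<zeta>p: "fastA l \<zeta> = fastA l (fs \<alpha>' p)" by (simp only: fastA_fs_def)
    have "b' \<le> l * Suc b' - 1" using l1 by (cases l) auto
    then have p: "max (mc \<alpha>') b' \<le> p"
      using add_le_funpow_fastA_fs[OF l1 lim', of "mc \<alpha>'" "l * Suc b' - 1"] by (simp add: p_def)
    have a_p: "u a \<le> p" using less.prems(4) mc\<zeta> p by (auto simp: a_def)
    have "0 < a" using mc_less_fastA[OF k1, of \<xi>] by (simp add: a_def)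
    show ?thesis
    proof (cases "up u \<xi>' < fs \<alpha>' p")
      case True
      have "fs \<alpha>' p < \<zeta>" using fs_less[of \<alpha>' p] lim' \<open>\<alpha>' \<le> \<zeta>\<close> by (simp add: is_limit_iff)
      moreover have "u a \<le> mc (fs \<alpha>' p)" using a_p le_mc_fs[OF lim', of p] by simp
      ultimately show ?thesis using less.IH[OF _ chain nxt True] A\<zeta>p by (simp add: a_def)
    next
      case False
      moreover have "0 < p" using a_p \<open>0 < a\<close> by (metis gr0I le_zero_eq u_eq_0_iff not_less_zero)
      ultimately obtain \<alpha> where \<alpha>: "is_limit \<alpha>" "\<xi>' < \<alpha>" "\<And>n. up u (fs \<alpha> n) = fs \<alpha>' (u n)" "near u (mc \<alpha>') (mc \<alpha>)"
        using ex_matching_limit[OF lim' \<open>up u \<xi>' < \<alpha>'\<close>, of p] by (metis not_less)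
      have above: "m < fastA k \<zeta>'" if "\<alpha> \<le> \<zeta>'" "fastA k \<xi> \<le> mc \<zeta>'" for \<zeta>'
        using nxt'(3) that \<alpha>(2) by (simp add: a_def)
      obtain y where y: "u y \<le> mc \<alpha>'" "mc \<alpha> \<le> Suc y" using \<alpha>(4) by (auto simp: near_def)
      have iter: "u m < (fastA_fs l \<alpha>' ^^ J) w" if "a \<le> z" "u z \<le> w" "m < (fastA_fs k \<alpha> ^^ J) z" for z w J
      proof (rule iterate_less[OF \<alpha>(1) lim' _ _ chain above _ _ that(2,3)])
        show "u m < fastA l \<zeta>''" if "\<zeta>'' < \<alpha>'" "nxt k m \<xi> \<xi>''" "up u \<xi>'' < \<zeta>''" "u (fastA k \<xi>) \<le> mc \<zeta>''" for \<zeta>'' \<xi>''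
          using less.IH[OF _ chain that(2-4)] that(1) \<open>\<alpha>' \<le> \<zeta>\<close> by simp
      qed (use \<alpha>(3) that(1) in \<open>simp_all add: a_def\<close>)
      show ?thesis
      proof (cases "u a \<le> mc \<alpha>'")
        case True
        then have "a \<le> mc \<alpha>" using \<alpha>(4) by (auto simp: near_def)
        \<comment> \<open>An iteration from \<open>mc \<alpha>'\<close> dominates one from
          \<open>z\<close>, but \<open>mc \<alpha>\<close> may be \<open>Suc z\<close>. One extra
          iteration repairs this, and \<open>Suc k \<le> l\<close> provides it.\<close>
        define z where "z = max y a"
        have z: "u z \<le> mc \<alpha>'" "a \<le> z" "mc \<alpha> \<le> Suc z" using True y by (auto simp: z_def u_max)
        have "m < (fastA_fs k \<alpha> ^^ k) (mc \<alpha>)"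
          using above[of \<alpha>] \<open>a \<le> mc \<alpha>\<close> fastA_limit[OF \<alpha>(1), of k] by (simp add: a_def)
        also have "\<dots> \<le> (fastA_fs k \<alpha> ^^ k) (fastA_fs k \<alpha> z)"
          using z(3) less_fastA_fs[OF k1 \<alpha>(1), of z] by (intro funpow_fastA_fs_mono k2 \<alpha>) simp
        finally have "m < (fastA_fs k \<alpha> ^^ Suc k) z" by (simp add: funpow_swap1)
        from iter[OF z(2,1) this] have "u m < (fastA_fs l \<alpha>' ^^ Suc k) (mc \<alpha>')" .
        also have "\<dots> \<le> fastA l \<zeta>" unfolding A\<zeta>
          by (rule funpow_fastA_fs_le[OF l1 lim']) (use kl in simp)
        finally show ?thesis .
      next
        case False
        then have b': "u a \<le> b'" using less.prems(4) mc\<zeta> by (auto simp: a_def)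
        have "mc \<alpha> \<le> a"
        proof (rule ccontr)
          assume "\<not> mc \<alpha> \<le> a"
          then have "u a \<le> u y" using y by simp
          then show False using y False by linarith
        qed
        \<comment> \<open>Now the finite part of \<zeta> supplies the large coefficient, so \<zeta>
          is compared with \<open>\<alpha> + a\<close>. The first \<open>u a\<close> iterations from
          \<open>mc \<alpha>'\<close> only serve to reach \<open>u a\<close>.\<close>
        define \<eta> where "\<eta> = \<alpha> + nat_e0 a"
        have "a \<le> mc \<eta>" "\<alpha> \<le> \<eta>"
          using mc_lim_fin[of \<eta>] lim_part_le[of \<eta>] lim_fin_add_nat[OF \<alpha>(1), of a] by (simp_all add: \<eta>_def)
        then have "m < (fastA_fs k \<alpha> ^^ (k * Suc a)) (mc \<alpha>)"
          using above[of \<eta>] fastA_limit_add[OF \<alpha>(1), of k a] by (simp add: \<eta>_def a_def)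
        also have "\<dots> \<le> (fastA_fs k \<alpha> ^^ (k * Suc a)) a"
          using \<open>mc \<alpha> \<le> a\<close> by (intro funpow_fastA_fs_mono k2 \<alpha>)
        finally have "m < (fastA_fs k \<alpha> ^^ (k * Suc a)) a" .
        moreover have "u a \<le> (fastA_fs l \<alpha>' ^^ u a) (mc \<alpha>')"
          using add_le_funpow_fastA_fs[OF l1 lim', of "mc \<alpha>'" "u a"] by simp
        ultimately have "u m < (fastA_fs l \<alpha>' ^^ (k * Suc a)) ((fastA_fs l \<alpha>' ^^ u a) (mc \<alpha>'))"
          using iter[of a] by simp
        also have "\<dots> = (fastA_fs l \<alpha>' ^^ (k * Suc a + u a)) (mc \<alpha>')" by (simp add: funpow_add)
        also have "\<dots> \<le> fastA l \<zeta>" unfolding A\<zeta>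
        proof (rule funpow_fastA_fs_le[OF l1 lim'])
          have "k * Suc a \<le> k * Suc b'" using le_u[of a] b' by (intro mult_le_mono2) simp
          then have "k * Suc a + u a \<le> k * Suc b' + Suc b'" using b' by linarith
          also have "\<dots> = Suc k * Suc b'" by simp
          also have "\<dots> \<le> l * Suc b'" using kl by (intro mult_le_mono1) simp
          finally show "k * Suc a + u a \<le> l * Suc b'" .
        qed
        finally show ?thesis .
      qed
    qed
  qed
qed

end

text \<open>Each chain member is in normal form for its own value, so \<open>u_knf\<close> evaluates
  \<open>u\<close> there; maximality comes from \<open>up_nxt_maximal\<close>.\<close>

lemma (in base_step) chain_up:
  assumes "chain k m \<xi>"
  shows "chain l (u m) (up u \<xi>)"
  using assms
proof (induction rule: chain.induct)
  case chain_0
  then show ?case by (simp add: chain.chain_0)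
next
  case (chain_step \<xi> \<xi>')
  have val: "u (fastA k \<eta>) = fastA l (up u \<eta>)" if "chain k m \<eta>" for \<eta>
    using u_knf chain_le[OF that] knf_of_chain chain_restrict[OF k1 that] by simp
  have "chain k m \<xi>'" using chain_step chain.chain_step by blast
  have "nxt l (u m) (up u \<xi>) (up u \<xi>')"
    unfolding nxt_def
  proof (intro conjI allI impI)
    show "fastA l (up u \<xi>') \<le> u m" using val[OF \<open>chain k m \<xi>'\<close>] chain_le[OF \<open>chain k m \<xi>'\<close>]
      by (metis u_le_iff)
    show "fastA l (up u \<xi>) \<le> mc (up u \<xi>')"
      using chain_step val[of \<xi>] by (metis mc_up nxt_def u_le_iff)
    show "\<zeta> \<le> up u \<xi>'" if "fastA l \<zeta> \<le> u m" "fastA l (up u \<xi>) \<le> mc \<zeta>" for \<zeta>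
      using up_nxt_maximal[OF chain_step(1,2), of \<zeta>] that val[OF chain_step(1)] by fastforce
  qed
  then show ?case using chain_step chain.chain_step by blast
qed

text \<open>For a finite target base the powers remain powers of \<omega>, so base change of an
  ordinal acts on its coefficients alone.\<close>

lemma base_change_e0_eq_up:
  assumes "coeff_map u" "\<And>b. b \<in> coeffs \<xi> \<Longrightarrow> base_change_nat k l b = u b"
  shows "base_change_e0 k l \<xi> = up u \<xi>"
proof -
  interpret coeff_map u by fact
  have "base_change_e0 k l \<xi> = up u \<xi>"
    if "Rep_e0 \<xi> = x" "\<And>b. b \<in> coeffs_cnf x \<Longrightarrow> base_change_nat k l b = u b" for x \<xi>
    using that
  proof (induction x arbitrary: \<xi>)
    case Z
    then have "\<xi> = 0" by (simp add: Rep_e0_inject[symmetric] zero_e0.rep_eq)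
    then show ?case by (simp add: base_change_e0.simps)
  next
    case (W a b c)
    have nf: "nf a" "nf c" using Rep_e0[of \<xi>] W.prems by auto
    then have Rep: "Rep_e0 (Abs_e0 a) = a" "Rep_e0 (Abs_e0 c) = c" by (simp_all add: Abs_e0_inverse)
    then have "is_nf \<xi> (Abs_e0 a) b (Abs_e0 c)" using W.prems by (simp add: Rep_is_nf)
    from base_change_nf[OF this, of k l]
    have "base_change_e0 k l \<xi> = omega_mult (up u (Abs_e0 a)) (u b) + up u (Abs_e0 c)"
      using W.IH(1)[OF Rep(1)] W.IH(2)[OF Rep(2)] W.prems by simp
    moreover have "is_nf (up u \<xi>) (up u (Abs_e0 a)) (u b) (up u (Abs_e0 c))"
      using W.prems Rep by (simp add: Rep_is_nf Rep_up)
    ultimately show ?case by (simp add: is_nf_def)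
  qed
  then show ?thesis using assms(2) by (simp add: coeffs.rep_eq)
qed

lemma knf_mc_less: "1 \<le> k \<Longrightarrow> knf k m \<xi> \<Longrightarrow> mc \<xi> < m"
  using mc_less_fastA[of k \<xi>] by (auto simp: knf_def)

lemma knf_1: "knf k 1 0"
  using knf_of_chain[of k 0] chain_0[of 1 k] by (simp add: fastA_0)

lemma base_stepI:
  assumes "2 \<le> k" "k < l" "coeff_map u" "\<And>n. n \<le> m \<Longrightarrow> base_change_nat k l n = u n"
  shows "base_step u k l m"
proof -
  have "u n = fastA l (up u \<xi>)" if "n \<le> m" "knf k n \<xi>" for n \<xi>
  proof -
    have "base_change_nat k l b = u b" if "b \<in> coeffs \<xi>" for b
      using coeffs_le_mc[OF that] knf_mc_less[OF _ \<open>knf k n \<xi>\<close>] \<open>n \<le> m\<close> assms(1) by (intro assms(4)) simp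
    then have "base_change_e0 k l \<xi> = up u \<xi>" using base_change_e0_eq_up assms(3) by blast
    then show ?thesis using base_change_knf[OF assms(1) that(2)] assms(4)[OF that(1)] by simp
  qed
  then show ?thesis using assms by (simp add: base_step_def base_step_axioms_def)
qed

lemma base_change_nat_0: "base_change_nat k l 0 = 0"
  by (simp add: base_change_nat.simps)

lemma base_change_nat_1:
  assumes "2 \<le> k"
  shows "base_change_nat k l 1 = 1"
  using base_change_knf[OF assms knf_1] by (simp add: base_change_e0.simps fastA_0)

text \<open>Only consecutive numbers need to be compared, so that a strictly increasing extension of
  the base change restricted to the numbers up to \<open>m\<close> is available.\<close>

lemma strict_mono_base_change_nat:
  assumes "2 \<le> k" "k < l"
  shows "strict_mono (base_change_nat k l)"
proof -
  have "base_change_nat k l m < base_change_nat k l (Suc m)" for m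
  proof (induction m rule: less_induct)
    case (less m)
    show ?case
    proof (cases "m = 0")
      case True
      then show ?thesis using base_change_nat_1[OF assms(1), of l] by (simp add: base_change_nat_0)
    next
      case False
      \<comment> \<open>Beyond \<open>m\<close> the map continues with slope one, so its
        monotonicity uses only comparisons already established.\<close>
      define u where "u n = (if n \<le> m then base_change_nat k l n else base_change_nat k l m + (n - m))" for n
      have "coeff_map u"
      proof
        have "u n < u (Suc n)" for n
          using less[of n] by (cases n m rule: linorder_cases) (auto simp: u_def)
        then show "strict_mono u" by (simp add: strict_mono_Suc_iff)
        show "u 0 = 0" "u (Suc 0) = Suc 0"
          using False base_change_nat_1[OF assms(1), of l] by (auto simp: u_def base_change_nat_0)
      qed
      then interpret base_step u k l m
        using assms by (intro base_stepI) (auto simp: u_def)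
      obtain \<eta> where \<eta>: "knf k (Suc m) \<eta>" using knf_ex1[OF assms(1), of "Suc m"] by blast
      then have \<eta>': "chain k (Suc m) \<eta>" "fastA k \<eta> = Suc m" by (simp_all add: knf_iff_chain assms)
      have mc: "mc \<eta> \<le> m" using knf_mc_less[OF k1 \<eta>] by simp
      have bc: "base_change_nat k l (Suc m) = fastA l (up u \<eta>)"
        unfolding base_change_knf[OF assms(1) \<eta>]
        by (subst base_change_e0_eq_up[OF \<open>coeff_map u\<close>])
          (use mc coeffs_le_mc[of _ \<eta>] in \<open>fastforce simp: u_def\<close>)+
      have "u m < fastA l (up u \<eta>)"
        using \<eta>'(1)
      proof cases
        case chain_0
        then show ?thesis using \<eta>'(2) False by (simp add: fastA_0)
      next
        \<comment> \<open>\<xi> precedes \<eta> in the chain for \<open>Suc m\<close>. If its value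
          is below \<open>m\<close>, then \<eta> lies above the member following \<xi> in the chain
          for \<open>m\<close>; otherwise \<eta> has a coefficient at least
          \<open>m\<close>.\<close>
        case (chain_step \<xi>)
        then have le: "fastA k \<xi> \<le> mc \<eta>" by (simp add: nxt_def)
        show ?thesis
        proof (cases "fastA k \<xi> < m")
          case True
          have chain: "chain k m \<xi>" using chain_restrict[OF k1 chain_step(1)] True by simp
          obtain \<xi>' where \<xi>': "nxt k m \<xi> \<xi>'" using ex_nxt[OF k2 True] by blast
          then have "\<xi>' \<le> \<eta>" "\<xi>' \<noteq> \<eta>" using chain_step(2) \<eta>'(2) by (auto simp: nxt_def)
          then show ?thesis using up_nxt_maximal[OF chain \<xi>', of "up u \<eta>"] le by (simp add: mc_up)
        next
          case False
          then have "u m \<le> mc (up u \<eta>)" using le by (simp add: mc_up)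
          then show ?thesis using mc_less_fastA[OF l1, of "up u \<eta>"] by simp
        qed
      qed
      then show ?thesis by (simp add: bc) (simp add: u_def)
    qed
  qed
  then show ?thesis by (simp add: strict_mono_Suc_iff)
qed

lemma base_step_base_change:
  assumes "2 \<le> k" "k < l"
  shows "base_step (base_change_nat k l) k l m"
  using strict_mono_base_change_nat[OF assms] base_change_nat_1[OF assms(1), of l]
  by (intro base_stepI assms) (auto intro!: coeff_map.intro simp: base_change_nat_0)

lemma knf_base_change:
  assumes "2 \<le> k" "k < l" "knf k m \<xi>"
  shows "knf l (base_change_nat k l m) (up (base_change_nat k l) \<xi>)"
proof -
  interpret base_step "base_change_nat k l" k l m by (rule base_step_base_change[OF assms(1,2)])
  show ?thesis
    using chain_up[of \<xi>] u_knf[OF _ assms(3)] assms(3) by (simp add: knf_iff_chain k2 l2)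
qed

section \<open>Wellfoundedness of the collapsed order\<close>

text \<open>\<open>Node a b c\<close> stands for \<open>\<Omega>\<^sup>a * A\<^sub>\<omega>(b) + c\<close>. The relation \<open>tless\<close> compares such ordinals and
  \<open>cless\<close> compares their images under \<open>A\<^sub>\<omega>\<close>.\<close>

datatype tree = Leaf | Node tree tree tree

primrec tcoeffs :: "tree \<Rightarrow> tree set" where
  "tcoeffs Leaf = {}"
| "tcoeffs (Node a b c) = insert b (tcoeffs a \<union> tcoeffs c)"

text \<open>The rules for \<open>cless\<close> mirror the recursion of the collapse:
  \<open>A\<^sub>\<omega>(x) < A\<^sub>\<omega>(y)\<close> if \<open>x < y\<close> and all
  coefficients of \<open>x\<close> lie below \<open>A\<^sub>\<omega>(y)\<close>, or if
  \<open>A\<^sub>\<omega>(x)\<close> is at most a coefficient of \<open>y\<close>.\<close>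

inductive tless :: "tree \<Rightarrow> tree \<Rightarrow> bool" and cless :: "tree \<Rightarrow> tree \<Rightarrow> bool" where
  tless_Leaf: "tless Leaf (Node a b c)"
| tless_exp: "tless a a' \<Longrightarrow> tless (Node a b c) (Node a' b' c')"
| tless_coeff: "cless b b' \<Longrightarrow> tless (Node a b c) (Node a b' c')"
| tless_rem: "tless c c' \<Longrightarrow> tless (Node a b c) (Node a b c')"
| cless_tless: "tless x y \<Longrightarrow> \<forall>b\<in>tcoeffs x. cless b y \<Longrightarrow> cless x y"
| cless_coeff: "b \<in> tcoeffs y \<Longrightarrow> x = b \<or> cless x b \<Longrightarrow> cless x y"

inductive_cases tless_NodeE: "tless x (Node a b c)"
inductive_cases tless_LeafE: "tless x Leaf"

text \<open>Decreasing exponents suffice for a normal form: coefficients are values of the collapse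
  and hence positive and countable.\<close>

primrec tnf :: "tree \<Rightarrow> bool" where
  "tnf Leaf \<longleftrightarrow> True"
| "tnf (Node a b c) \<longleftrightarrow> tnf a \<and> tnf b \<and> tnf c \<and> (\<forall>a' b' c'. c = Node a' b' c' \<longrightarrow> tless a' a)"

lemma tnf_tcoeffs: "tnf x \<Longrightarrow> b \<in> tcoeffs x \<Longrightarrow> tnf b"
  by (induction x) auto

lemma size_tcoeffs: "b \<in> tcoeffs x \<Longrightarrow> size b < size x"
  by (induction x) auto

definition cless_rel :: "(tree \<times> tree) set" where
  "cless_rel = {(x, y). tnf x \<and> tnf y \<and> cless x y}"

definition acc_coeffs :: "tree set" where
  "acc_coeffs = {x. tnf x \<and> tcoeffs x \<subseteq> Wellfounded.acc cless_rel}"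

lemma acc_coeffs_Node:
  "Node a b c \<in> acc_coeffs \<longleftrightarrow> a \<in> acc_coeffs \<and> tnf b \<and> b \<in> Wellfounded.acc cless_rel \<and> c \<in> acc_coeffs
     \<and> (\<forall>a' b' c'. c = Node a' b' c' \<longrightarrow> tless a' a)"
  by (auto simp: acc_coeffs_def)

lemma Leaf_acc: "Leaf \<in> Wellfounded.acc {(x, y). x \<in> S \<and> y \<in> S \<and> tless x y}"
  by (rule acc.accI) (auto elim: tless_LeafE)

text \<open>Nested induction on exponent, coefficient and remainder, as in \<open>wf_cnf\<close>;
  the coefficients are accessible for \<open>cless_rel\<close> by the choice of
  \<open>acc_coeffs\<close>.\<close>

lemma tless_acc:
  "x \<in> acc_coeffs \<Longrightarrow> x \<in> Wellfounded.acc {(x, y). x \<in> acc_coeffs \<and> y \<in> acc_coeffs \<and> tless x y}"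
  (is "_ \<Longrightarrow> _ \<in> Wellfounded.acc ?R")
proof (induction x)
  case Leaf
  show ?case by (rule Leaf_acc)
next
  case (Node a b c)
  have "Node a b c \<in> Wellfounded.acc ?R"
    if "a \<in> Wellfounded.acc ?R" "Node a b c \<in> acc_coeffs" for a b c
    using that
  proof (induction a arbitrary: b c rule: acc.induct)
    case outer: (accI a)
    have small: "c \<in> Wellfounded.acc ?R"
      if "c \<in> acc_coeffs" "a \<in> acc_coeffs" "\<And>a' b' c'. c = Node a' b' c' \<Longrightarrow> tless a' a" for c
    proof (cases c)
      case Leaf
      then show ?thesis using Leaf_acc by simp
    next
      case (Node a' b' c')
      then show ?thesis using outer.IH[of a' b' c'] that by (auto simp: acc_coeffs_Node)
    qed
    have "b \<in> Wellfounded.acc cless_rel" using outer.prems by (simp add: acc_coeffs_Node)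
    then show ?case using outer.prems
    proof (induction b arbitrary: c rule: acc.induct)
      case middle: (accI b)
      have "c \<in> Wellfounded.acc ?R" using small middle.prems by (auto simp: acc_coeffs_Node)
      then show ?case using middle.prems
      proof (induction c rule: acc.induct)
        case inner: (accI c)
        show ?case
        proof (rule acc.accI)
          fix y assume y: "(y, Node a b c) \<in> ?R"
          then have "tless y (Node a b c)" by simp
          then show "y \<in> Wellfounded.acc ?R"
          proof (rule tless_NodeE)
            show "y \<in> Wellfounded.acc ?R" if "y = Leaf"
              using Leaf_acc that by simp
            show "y \<in> Wellfounded.acc ?R" if "y = Node a' b' c'" "tless a' a" for a' b' c'
              using outer.IH[of a' b' c'] y that by (auto simp: acc_coeffs_Node)
            show "y \<in> Wellfounded.acc ?R" if "y = Node a b' c'" "cless b' b" for b' c'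
            proof -
              have "(b', b) \<in> cless_rel" using y that by (auto simp: acc_coeffs_Node cless_rel_def)
              then show ?thesis using middle.IH[of b' c'] y that by auto
            qed
            show "y \<in> Wellfounded.acc ?R" if "y = Node a b c'" "tless c' c" for c'
              using inner.IH[of c'] y inner.prems that by (auto simp: acc_coeffs_Node)
          qed
        qed
      qed
    qed
  qed
  then show ?case using Node by (simp add: acc_coeffs_Node)
qed

text \<open>Induction along \<open>tless\<close>, then on the size of a collapsed predecessor
  \<open>y\<close>. By \<open>cless_tless\<close> the coefficients of \<open>y\<close> are smaller
  predecessors, so \<open>y\<close> is in \<open>acc_coeffs\<close> and the outer hypothesis
  applies; by \<open>cless_coeff\<close>, \<open>y\<close> is at most an accessible
  coefficient.\<close>

lemma acc_coeffs_acc: "x \<in> acc_coeffs \<Longrightarrow> x \<in> Wellfounded.acc cless_rel"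
proof -
  assume "x \<in> acc_coeffs"
  from tless_acc[OF this] this show ?thesis
  proof (induction x rule: acc.induct)
    case (accI x)
    have "y \<in> Wellfounded.acc cless_rel" if "tnf y" "cless y x" for y
      using that
    proof (induction "size y" arbitrary: y rule: less_induct)
      case less
      from less.prems(2) show ?case
      proof cases
        case cless_tless
        then have "tcoeffs y \<subseteq> Wellfounded.acc cless_rel"
          using less size_tcoeffs tnf_tcoeffs by blast
        then have "y \<in> acc_coeffs" using less.prems by (simp add: acc_coeffs_def)
        then show ?thesis using accI cless_tless by auto
      next
        case (cless_coeff b)
        then have b: "tnf b" "b \<in> Wellfounded.acc cless_rel"
          using accI.prems tnf_tcoeffs by (auto simp: acc_coeffs_def)
        then show ?thesis using cless_coeff less.prems by (auto intro: acc_downward simp: cless_rel_def)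
      qed
    qed
    then show ?case by (auto simp: cless_rel_def intro!: acc.accI[of x])
  qed
qed

text \<open>Coefficients are smaller trees, so induction on size puts every normal tree into
  \<open>acc_coeffs\<close>.\<close>

lemma wf_cless_rel: "wf cless_rel"
proof -
  have "x \<in> Wellfounded.acc cless_rel" if "tnf x" for x
    using that
  proof (induction "size x" arbitrary: x rule: less_induct)
    case less
    then show ?case
      using size_tcoeffs tnf_tcoeffs by (intro acc_coeffs_acc) (auto simp: acc_coeffs_def)
  qed
  then have "x \<in> Wellfounded.acc cless_rel" for x
    by (cases "tnf x") (auto intro: acc.accI simp: cless_rel_def)
  then show ?thesis by (simp add: wf_iff_acc)
qed

section \<open>Normal forms as trees\<close>

primrec cnf_tree :: "(nat \<Rightarrow> tree) \<Rightarrow> cnf \<Rightarrow> tree" where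
  "cnf_tree f Z = Leaf"
| "cnf_tree f (W a b c) = Node (cnf_tree f a) (f b) (cnf_tree f c)"

text \<open>Shows the termination proof of \<open>nat_tree\<close> that its recursive calls are made
  at coefficients only.\<close>

lemma cnf_tree_cong [fundef_cong]:
  "x = y \<Longrightarrow> (\<And>b. b \<in> coeffs_cnf y \<Longrightarrow> f b = g b) \<Longrightarrow> cnf_tree f x = cnf_tree g y"
  by (induction y arbitrary: x) auto

lemma cnf_tree_map_coeffs: "cnf_tree f (map_coeffs u x) = cnf_tree (\<lambda>b. f (u b)) x"
  by (induction x) auto

function nat_tree :: "nat \<Rightarrow> nat \<Rightarrow> tree" where
  "nat_tree k m = (if m = 0 \<or> k < 2 then Leaf else cnf_tree (nat_tree k) (Rep_e0 (THE \<xi>. knf k m \<xi>)))"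
  by auto
termination
proof (relation "measure snd", goal_cases)
  case (2 k m b)
  then have "knf k m (THE \<xi>. knf k m \<xi>)" using theI'[OF knf_ex1[of k m]] by simp
  then have "mc (THE \<xi>. knf k m \<xi>) < m" using knf_mc_less[of k m] 2 by simp
  then show ?case using 2 coeffs_le_mc[of b "THE \<xi>. knf k m \<xi>"] by (simp add: coeffs.rep_eq)
qed simp

declare nat_tree.simps [simp del]

lemma nat_tree_knf:
  assumes "2 \<le> k" "knf k m \<xi>"
  shows "nat_tree k m = cnf_tree (nat_tree k) (Rep_e0 \<xi>)"
proof -
  have "0 < m" using assms(2) by (simp add: knf_def)
  then have "(THE \<xi>. knf k m \<xi>) = \<xi>" using knf_ex1[OF assms(1)] assms(2) by (blast intro: the1_equality)
  then show ?thesis using \<open>0 < m\<close> assms(1) by (subst nat_tree.simps) simp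
qed

lemma nat_tree_base_change:
  assumes "2 \<le> k" "k < l"
  shows "nat_tree l (base_change_nat k l m) = nat_tree k m"
proof (induction m rule: less_induct)
  case (less m)
  show ?case
  proof (cases "m = 0")
    case True
    then show ?thesis by (simp add: base_change_nat_0 nat_tree.simps)
  next
    case False
    then obtain \<xi> where \<xi>: "knf k m \<xi>" using knf_ex1[OF assms(1)] by blast
    interpret base_step "base_change_nat k l" k l m by (rule base_step_base_change[OF assms])
    have "nat_tree l (base_change_nat k l m) = cnf_tree (\<lambda>b. nat_tree l (base_change_nat k l b)) (Rep_e0 \<xi>)"
      using nat_tree_knf[OF l2 knf_base_change[OF assms \<xi>]] by (simp add: Rep_up cnf_tree_map_coeffs)
    also have "\<dots> = cnf_tree (nat_tree k) (Rep_e0 \<xi>)"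
    proof (rule cnf_tree_cong[OF refl])
      show "nat_tree l (base_change_nat k l b) = nat_tree k b" if "b \<in> coeffs_cnf (Rep_e0 \<xi>)" for b
        using that coeffs_le_mc[of b \<xi>] knf_mc_less[OF k1 \<xi>] by (intro less) (simp add: coeffs.rep_eq)
    qed
    finally show ?thesis using nat_tree_knf[OF assms(1) \<xi>] by simp
  qed
qed

text \<open>The comparison of \<open>f\<close> is assumed only on actual coefficients, so that the
  induction hypothesis of \<open>cless_nat_tree\<close> can supply it.\<close>

lemma tless_cnf_tree:
  assumes "nf x" "nf y" "x < y"
    and "\<And>b b'. b \<in> coeffs_cnf x \<Longrightarrow> b' \<in> coeffs_cnf y \<Longrightarrow> 0 < b \<Longrightarrow> b < b' \<Longrightarrow> cless (f b) (f b')"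
  shows "tless (cnf_tree f x) (cnf_tree f y)"
  using assms
proof (induction x arbitrary: y)
  case Z
  then show ?case by (cases y) (auto intro: tless_Leaf)
next
  case (W a b c)
  then obtain a' b' c' where y: "y = W a' b' c'" by (cases y) auto
  then consider "a < a'" | "a = a'" "b < b'" | "a = a'" "b = b'" "c < c'" using W.prems by auto
  then show ?case
  proof cases
    case 1
    then show ?thesis using W.IH(1)[of a'] W.prems y by (auto intro: tless_exp)
  next
    case 2
    then show ?thesis using W.prems y by (auto intro: tless_coeff)
  next
    case 3
    then show ?thesis using W.IH(2)[of c'] W.prems y by (auto intro: tless_rem)
  qed
qed

lemma tcoeffs_cnf_tree: "nf x \<Longrightarrow> tcoeffs (cnf_tree f x) = f ` (coeffs_cnf x - {0})"
  by (induction x) auto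

text \<open>Let \<xi> precede \<eta> in the chain for \<open>n\<close>. If its value is at least
  \<open>m\<close>, then so is a coefficient of \<eta>. Otherwise \<xi> also belongs to the chain
  for \<open>m\<close>, so \<zeta> is a competitor and maximality gives
  \<open>\<zeta> \<le> \<eta>\<close>. Positivity of \<open>m\<close> matters: 0 and 1 have the same
  tree.\<close>

lemma cless_nat_tree:
  assumes "2 \<le> k" "0 < m" "m < n"
  shows "cless (nat_tree k m) (nat_tree k n)"
  using assms(2,3)
proof (induction "m + n" arbitrary: m n rule: less_induct)
  case less
  have k1: "1 \<le> k" using assms(1) by simp
  obtain \<zeta> \<eta> where \<zeta>: "knf k m \<zeta>" and \<eta>: "knf k n \<eta>"
    using knf_ex1[OF assms(1)] less.prems by (metis less_trans)
  have nf: "nf (Rep_e0 \<xi>)" for \<xi> using Rep_e0[of \<xi>] by simp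
  have t: "nat_tree k m = cnf_tree (nat_tree k) (Rep_e0 \<zeta>)" "nat_tree k n = cnf_tree (nat_tree k) (Rep_e0 \<eta>)"
    using nat_tree_knf[OF assms(1)] \<zeta> \<eta> by blast+
  have mc: "mc \<zeta> < m" "mc \<eta> < n" using knf_mc_less[OF k1] \<zeta> \<eta> by blast+
  have le_mc: "b \<in> coeffs_cnf (Rep_e0 \<xi>) \<Longrightarrow> b \<le> mc \<xi>" for b \<xi>
    using coeffs_le_mc[of b \<xi>] by (simp add: coeffs.rep_eq)
  have "chain k n \<eta>" "fastA k \<eta> = n" "fastA k \<zeta> = m" using \<zeta> \<eta> by (simp_all add: knf_iff_chain assms(1))
  from this(1) show ?case
  proof cases
    case chain_0
    then show ?thesis using \<open>fastA k \<eta> = n\<close> less.prems by (simp add: fastA_0)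
  next
    case (chain_step \<xi>)
    then have le: "fastA k \<xi> \<le> mc \<eta>" by (simp add: nxt_def)
    show ?thesis
    proof (cases "fastA k \<xi> < m")
      case False
      then have m: "m \<le> mc \<eta>" using le by simp
      have "mc \<eta> \<in> coeffs_cnf (Rep_e0 \<eta>)"
        using zero_in_coeffs_cnf[of "Rep_e0 \<eta>"] by (auto simp: mc_def coeffs.rep_eq intro: Max_in)
      then have "nat_tree k (mc \<eta>) \<in> tcoeffs (nat_tree k n)"
        using m less.prems by (simp add: t tcoeffs_cnf_tree nf)
      moreover have "nat_tree k m = nat_tree k (mc \<eta>) \<or> cless (nat_tree k m) (nat_tree k (mc \<eta>))"
        using less.hyps[of m "mc \<eta>"] m mc less.prems by (cases "m = mc \<eta>") auto
      ultimately show ?thesis by (rule cless_coeff)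
    next
      case True
      have "chain k m \<xi>" using chain_restrict[OF k1 chain_step(1)] True less.prems by simp
      then have "fastA k \<xi> \<le> mc \<zeta>" using knf_coeff_ge[OF assms(1) _ True \<zeta>] by simp
      then have "\<zeta> \<le> \<eta>" using chain_step(2) \<open>fastA k \<zeta> = m\<close> less.prems by (simp add: nxt_def)
      then have "Rep_e0 \<zeta> < Rep_e0 \<eta>"
        using \<open>fastA k \<eta> = n\<close> \<open>fastA k \<zeta> = m\<close> less.prems by (auto simp: le_less less_e0.rep_eq)
      then have "tless (nat_tree k m) (nat_tree k n)"
        unfolding t
      proof (rule tless_cnf_tree[OF nf nf])
        fix b b' assume b: "b \<in> coeffs_cnf (Rep_e0 \<zeta>)" "b' \<in> coeffs_cnf (Rep_e0 \<eta>)" "0 < b" "b < b'"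
        then show "cless (nat_tree k b) (nat_tree k b')"
          using le_mc[OF b(1)] le_mc[OF b(2)] mc by (intro less.hyps) auto
      qed
      moreover have "cless t (nat_tree k n)" if mem: "t \<in> tcoeffs (nat_tree k m)" for t
      proof -
        obtain b where "t = nat_tree k b" "b \<in> coeffs_cnf (Rep_e0 \<zeta>)" "0 < b"
          using mem unfolding t(1) tcoeffs_cnf_tree[OF nf] by auto
        then show ?thesis using le_mc[of b \<zeta>] mc less.prems less.hyps[of b n] by simp
      qed
      ultimately show ?thesis by (intro cless_tless) auto
    qed
  qed
qed

lemma tnf_cnf_tree:
  assumes "nf x" "\<And>b. b \<in> coeffs_cnf x \<Longrightarrow> tnf (f b)"
    and "\<And>b b'. 0 < b \<Longrightarrow> b < b' \<Longrightarrow> cless (f b) (f b')"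
  shows "tnf (cnf_tree f x)"
  using assms(1,2)
proof (induction x)
  case (W a b c)
  have "tless a' (cnf_tree f a)" if "cnf_tree f c = Node a' b' c'" for a' b' c'
    using that W.prems(1) tless_cnf_tree[of _ a f] assms(3) by (cases c) (auto simp: less_W1_nf)
  then show ?case using W by auto
qed simp

lemma tnf_nat_tree:
  assumes "2 \<le> k"
  shows "tnf (nat_tree k m)"
proof (induction m rule: less_induct)
  case (less m)
  show ?case
  proof (cases "m = 0")
    case True
    then show ?thesis by (simp add: nat_tree.simps)
  next
    case False
    then obtain \<xi> where \<xi>: "knf k m \<xi>" using knf_ex1[OF assms] by blast
    have "tnf (nat_tree k b)" if "b \<in> coeffs_cnf (Rep_e0 \<xi>)" for b
      using that coeffs_le_mc[of b \<xi>] knf_mc_less[OF _ \<xi>] assms by (intro less) (simp add: coeffs.rep_eq)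
    then show ?thesis
      unfolding nat_tree_knf[OF assms \<xi>]
      using Rep_e0[of \<xi>] cless_nat_tree[OF assms] by (intro tnf_cnf_tree) auto
  qed
qed

theorem theorem8p1:
  fixes m :: nat
  shows "\<exists>i. fast_goodstein m i = 0"
proof (rule ccontr)
  assume "\<not> ?thesis"
  then have pos: "0 < fast_goodstein m i" for i by simp
  define t where "t i = nat_tree (i + 2) (fast_goodstein m i)" for i
  have "(t (Suc i), t i) \<in> cless_rel" for i
  proof -
    let ?g = "base_change_nat (i + 2) (i + 3) (fast_goodstein m i)"
    have "fast_goodstein m (Suc i) = ?g - 1" using pos[of i] by simp
    \<comment> \<open>The next term is positive by \<open>pos\<close>, as required for comparing
      trees.\<close>
    then have "cless (nat_tree (i + 3) (fast_goodstein m (Suc i))) (nat_tree (i + 3) ?g)"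
      using pos[of "Suc i"] by (intro cless_nat_tree) simp_all
    also have "nat_tree (i + 3) ?g = t i"
      unfolding t_def by (rule nat_tree_base_change) simp_all
    finally show ?thesis
      using tnf_nat_tree by (simp add: cless_rel_def t_def numeral_3_eq_3)
  qed
  then show False using wf_cless_rel unfolding wf_iff_no_infinite_down_chain by blast
qed

end
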